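(* Let $\mathcal{P}=(P,\{\,,\,\})$, $P=P_0\ltimes P_1$, be an admissible Poisson algebra with corresponding Poisson triple $([\,,\,]_1,\mathcal{D},\mathcal{K})$. Let $X:P\to P$ be an $R$-linear map with components $X_{ij}:P_j\to P_i$ satisfying: $X_{00}\in\mathrm{Der}(P_0)$; $X_{01}\in\varepsilon(P_1;P_0)$; $X_{10}\in\mathrm{Der}(P_0;P_1)$; and $X_{11}(f\eta)=fX_{11}\eta+(X_{00}f)\eta$ for all $f\in P_0$, $\eta\in P_1$. Then $X$ is a derivation of the Poisson algebra $\mathcal{P}$ if and only if for all $f\oplus\eta,g\oplus\xi\in P$: \begin{align*} X_{00}\{f,g\}_0&=\{X_{00}f,g\}_0+\{f,X_{00}g\}_0-X_{01}(\mathcal{K}(df,dg)),\\ X_{11}[\eta,\xi]_1&=[X_{11}\eta,\xi]_1+[\eta,X_{11}\xi]_1+\mathcal{D}_{dX_{01}\eta}\xi-\mathcal{D}_{dX_{01}\xi}\eta,\\ X_{10}\{f,g\}_0&=\mathscr{T}_{X_{00}f\oplus X_{10}f}(g)-\mathscr{T}_{X_{00}g\oplus X_{10}g}(f)-X_{11}(\mathcal{K}(df,dg)),\\ X_{11}(\mathcal{D}_{df}\eta)&=(\mathcal{D}_{dX_{00}f}+\mathrm{ad}_{X_{10}f})(\eta)-\mathscr{T}_{X_{01}\eta\oplus X_{11}\eta}(f),\\ X_{01}\circ\mathrm{ad}_\eta&=0,\\ X_{01}\circ\mathcal{D}_{df}&=\mathrm{ad}^0_f\circ X_{01}. \end{a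lign*}
   Context: Let $R$ be a commutative ring with unit, $\mathcal{P}_0=(P_0,\cdot,\{\,,\,\}_0)$ a Poisson $R$-algebra (commutative associative unital $R$-algebra with an $R$-bilinear Lie bracket that is a derivation in each argument), $P_1$ a faithful $P_0$-module, and $P=P_0\ltimes P_1$ the $R$-module $P_0\oplus P_1$ with product $(f\oplus\eta)(g\oplus\xi)=fg\oplus(f\xi+g\eta)$. An admissible Poisson structure on $P$ is a Poisson structure with $\mathrm{pr}_0\{f\oplus\eta,g\oplus\xi\}=\{f,g\}_0$; $(P,\{\,,\,\})$ is then an admissible Poisson algebra. $\Omega^1_{P_0}$ is the module of Kähler differentials of $P_0$ over $R$ with universal derivation $d$, anchor $\varrho_{P_0}(dh)=\{h,\cdot\}_0$ (extended $P_0$-linearly). A contravariant derivative on $P_1$ is an $R$-bilinear map $\mathcal{D}:\Omega^1_{P_0}\times P_1\to P_1$ with $\mathcal{D}_{f\alpha}\eta=f\mathcal{D}_\alpha\eta$, $\mathcal{D}_\alpha(f\eta)=f\mathcal{D}_\alpha\eta+\varrho_{P_0}(\alpha)(f)\eta$. Every admissible Poisson algebra has a unique corresponding Poisson triple $([\,,\,]_1,\mathcal{D},\mathcal{K})$, where $[\,,\,]_1$ is a $P_0$-linear Lie bracket on $P_1$, $\mathcal{D}$ a contravariant derivative on $P_1$, and $\mathcal{K}:\Omega^1_{P_0}\times\Omega^1_{P_0}\to P_1$ a $P_0$-bilinear skew-symmetric map, such that $\{f\oplus\eta,g\oplus\xi\}=\{f,g\}_0\oplus(\mathcal{D}_{df}\xi-\mathcal{D}_{dg}\eta+[\eta,\xi]_1+\mathcal{K}(df,dg))$.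 Components: $X(f\oplus\eta)=(X_{00}f+X_{01}\eta)\oplus(X_{10}f+X_{11}\eta)$. $\mathrm{Der}(P_0)$: $R$-linear derivations of the algebra $P_0$. $\mathrm{Der}(P_0;P_1)$: $R$-linear $D:P_0\to P_1$ with $D(fg)=fDg+gDf$. $\varepsilon(P_1;P_0)$: $P_0$-linear maps $T:P_1\to P_0$ with $T(\xi)\eta+T(\eta)\xi=0$ for all $\eta,\xi\in P_1$. $\mathrm{ad}^0_f=\{f,\cdot\}_0$, $\mathrm{ad}_\eta=[\eta,\cdot]_1$, $\mathscr{T}_{f\oplus\eta}(g)=\mathcal{K}(df,dg)-\mathcal{D}_{dg}\eta$. A derivation of the Poisson algebra $\mathcal{P}$ is a derivation of the commutative algebra $P$ that is also a derivation of the bracket $\{\,,\,\}$. *)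

theory Defs
  imports "HOL-Algebra.Module" "HOL-Algebra.AbelCoset"
begin

section \<open>Linear and bilinear maps, change of scalars\<close>

definition linear_map ::
  "('r, 'k) ring_scheme \<Rightarrow> ('r, 'a, 'm) module_scheme \<Rightarrow> ('r, 'b, 'n) module_scheme \<Rightarrow> ('a \<Rightarrow> 'b) \<Rightarrow> bool"
  where "linear_map R M N T \<longleftrightarrow>
    T \<in> carrier M \<rightarrow> carrier N \<and>
    (\<forall>x\<in>carrier M. \<forall>y\<in>carrier M. T (x \<oplus>\<^bsub>M\<^esub> y) = T x \<oplus>\<^bsub>N\<^esub> T y) \<and>
    (\<forall>r\<in>carrier R. \<forall>x\<in>carrier M. T (r \<odot>\<^bsub>M\<^esub> x) = r \<odot>\<^bsub>N\<^esub> T x)"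

definition bilinear_map ::
  "('r, 'k) ring_scheme \<Rightarrow> ('r, 'a, 'm) module_scheme \<Rightarrow> ('r, 'b, 'n) module_scheme \<Rightarrow>
   ('r, 'c, 'l) module_scheme \<Rightarrow> ('a \<Rightarrow> 'b \<Rightarrow> 'c) \<Rightarrow> bool"
  where "bilinear_map R M N L B \<longleftrightarrow>
    (\<forall>x\<in>carrier M. linear_map R N L (B x)) \<and>
    (\<forall>y\<in>carrier N. linear_map R M L (\<lambda>x. B x y))"

text \<open>The ring operations \<open>mult\<close> and \<open>one\<close> of a module record carry no meaning; they are
  filled with \<open>undefined\<close> below whenever the object is only a module.\<close>

definition regular_module :: "('a, 'k) ring_scheme \<Rightarrow> ('a, 'a) module"
  where "regular_module A =
    \<lparr>carrier = carrier A, mult = mult A, one = one A, zero = zero A, add = add A, smult = mult A\<rparr>"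

text \<open>A module over an \<open>R\<close>-algebra \<open>A\<close>, viewed as an \<open>R\<close>-module along \<open>r \<mapsto> r \<cdot> 1\<^sub>A\<close>.\<close>

definition restrict_scalars ::
  "('r, 'k) ring_scheme \<Rightarrow> ('r, 'a, 'm) module_scheme \<Rightarrow> ('a, 'b, 'n) module_scheme \<Rightarrow> ('r, 'b) module"
  where "restrict_scalars R A M =
    \<lparr>carrier = carrier M, mult = mult M, one = one M, zero = zero M, add = add M,
     smult = (\<lambda>r x. (r \<odot>\<^bsub>A\<^esub> \<one>\<^bsub>A\<^esub>) \<odot>\<^bsub>M\<^esub> x)\<rparr>"

definition faithful_module :: "('a, 'k) ring_scheme \<Rightarrow> ('a, 'b, 'n) module_scheme \<Rightarrow> bool"
  where "faithful_module A M \<longleftrightarrow> module A M \<and>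
    (\<forall>a\<in>carrier A. (\<forall>x\<in>carrier M. a \<odot>\<^bsub>M\<^esub> x = \<zero>\<^bsub>M\<^esub>) \<longrightarrow> a = \<zero>\<^bsub>A\<^esub>)"

section \<open>Derivations and Poisson algebras\<close>

definition Der :: "('r, 'k) ring_scheme \<Rightarrow> ('r, 'a, 'm) module_scheme \<Rightarrow> ('a \<Rightarrow> 'a) set"
  where "Der R A = {D. linear_map R A A D \<and>
    (\<forall>f\<in>carrier A. \<forall>g\<in>carrier A. D (f \<otimes>\<^bsub>A\<^esub> g) = (D f \<otimes>\<^bsub>A\<^esub> g) \<oplus>\<^bsub>A\<^esub> (f \<otimes>\<^bsub>A\<^esub> D g))}"

definition Der_into ::
  "('r, 'k) ring_scheme \<Rightarrow> ('r, 'a, 'm) module_scheme \<Rightarrow> ('a, 'b, 'n) module_scheme \<Rightarrow> ('a \<Rightarrow> 'b) set"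
  where "Der_into R A M = {D. linear_map R A (restrict_scalars R A M) D \<and>
    (\<forall>f\<in>carrier A. \<forall>g\<in>carrier A. D (f \<otimes>\<^bsub>A\<^esub> g) = (f \<odot>\<^bsub>M\<^esub> D g) \<oplus>\<^bsub>M\<^esub> (g \<odot>\<^bsub>M\<^esub> D f))}"

definition lie_bracket ::
  "('r, 'k) ring_scheme \<Rightarrow> ('r, 'a, 'm) module_scheme \<Rightarrow> ('a \<Rightarrow> 'a \<Rightarrow> 'a) \<Rightarrow> bool"
  where "lie_bracket R M br \<longleftrightarrow>
    bilinear_map R M M M br \<and>
    (\<forall>x\<in>carrier M. br x x = \<zero>\<^bsub>M\<^esub>) \<and>
    (\<forall>x\<in>carrier M. \<forall>y\<in>carrier M. \<forall>z\<in>carrier M.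
       br x (br y z) \<oplus>\<^bsub>M\<^esub> br y (br z x) \<oplus>\<^bsub>M\<^esub> br z (br x y) = \<zero>\<^bsub>M\<^esub>)"

definition poisson_structure ::
  "('r, 'k) ring_scheme \<Rightarrow> ('r, 'a, 'm) module_scheme \<Rightarrow> ('a \<Rightarrow> 'a \<Rightarrow> 'a) \<Rightarrow> bool"
  where "poisson_structure R A br \<longleftrightarrow>
    lie_bracket R A br \<and>
    (\<forall>f\<in>carrier A. br f \<in> Der R A) \<and>
    (\<forall>g\<in>carrier A. (\<lambda>f. br f g) \<in> Der R A)"

definition poisson_algebra ::
  "('r, 'k) ring_scheme \<Rightarrow> ('r, 'a, 'm) module_scheme \<Rightarrow> ('a \<Rightarrow> 'a \<Rightarrow> 'a) \<Rightarrow> bool"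
  where "poisson_algebra R A br \<longleftrightarrow> algebra R A \<and> poisson_structure R A br"

definition poisson_derivation ::
  "('r, 'k) ring_scheme \<Rightarrow> ('r, 'a, 'm) module_scheme \<Rightarrow> ('a \<Rightarrow> 'a \<Rightarrow> 'a) \<Rightarrow> ('a \<Rightarrow> 'a) \<Rightarrow> bool"
  where "poisson_derivation R A br X \<longleftrightarrow>
    X \<in> Der R A \<and>
    (\<forall>a\<in>carrier A. \<forall>b\<in>carrier A. X (br a b) = br (X a) b \<oplus>\<^bsub>A\<^esub> br a (X b))"

section \<open>Kaehler differentials\<close>

definition free_module :: "('a, 'k) ring_scheme \<Rightarrow> 's set \<Rightarrow> ('a, 's \<Rightarrow> 'a) module"
  where "free_module A S =
    \<lparr>carrier = {s. (\<forall>x\<in>S. s x \<in> carrier A) \<and> (\<forall>x. x \<notin> S \<longrightarrow> s x = \<zero>\<^bsub>A\<^esub>) \<and>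
                  finite {x. s x \<noteq> \<zero>\<^bsub>A\<^esub>}},
     mult = undefined, one = undefined,
     zero = (\<lambda>_. \<zero>\<^bsub>A\<^esub>), add = (\<lambda>s t x. s x \<oplus>\<^bsub>A\<^esub> t x), smult = (\<lambda>a s x. a \<otimes>\<^bsub>A\<^esub> s x)\<rparr>"

definition free_gen :: "('a, 'k) ring_scheme \<Rightarrow> 's \<Rightarrow> 's \<Rightarrow> 'a"
  where "free_gen A x = (\<lambda>y. if y = x then \<one>\<^bsub>A\<^esub> else \<zero>\<^bsub>A\<^esub>)"

definition quotient_module :: "('a, 'b, 'm) module_scheme \<Rightarrow> 'b set \<Rightarrow> ('a, 'b set) module"
  where "quotient_module M N =
    \<lparr>carrier = a_rcosets\<^bsub>M\<^esub> N, mult = undefined, one = undefined,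
     zero = N, add = set_add M, smult = (\<lambda>a C. \<Union>x\<in>C. N +>\<^bsub>M\<^esub> (a \<odot>\<^bsub>M\<^esub> x))\<rparr>"

text \<open>\<open>\<Omega>\<^sup>1\<close> is the free \<open>A\<close>-module on the symbols \<open>free_gen A f\<close>, for \<open>f\<close> in \<open>A\<close>, modulo the
  relations making \<open>f \<mapsto> free_gen A f\<close> an \<open>R\<close>-linear derivation.\<close>

definition kahler_relations ::
  "('r, 'k) ring_scheme \<Rightarrow> ('r, 'a, 'm) module_scheme \<Rightarrow> ('a \<Rightarrow> 'a) set"
  where "kahler_relations R A = (let F = free_module A (carrier A); \<delta> = free_gen A in
     {\<delta> (f \<oplus>\<^bsub>A\<^esub> g) \<ominus>\<^bsub>F\<^esub> (\<delta> f \<oplus>\<^bsub>F\<^esub> \<delta> g) | f g. f \<in> carrier A \<and> g \<in> carrier A} \<union>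
     {\<delta> (r \<odot>\<^bsub>A\<^esub> f) \<ominus>\<^bsub>F\<^esub> ((r \<odot>\<^bsub>A\<^esub> \<one>\<^bsub>A\<^esub>) \<odot>\<^bsub>F\<^esub> \<delta> f) | r f. r \<in> carrier R \<and> f \<in> carrier A} \<union>
     {\<delta> (f \<otimes>\<^bsub>A\<^esub> g) \<ominus>\<^bsub>F\<^esub> ((f \<odot>\<^bsub>F\<^esub> \<delta> g) \<oplus>\<^bsub>F\<^esub> (g \<odot>\<^bsub>F\<^esub> \<delta> f)) | f g. f \<in> carrier A \<and> g \<in> carrier A})"

definition kahler_submodule ::
  "('r, 'k) ring_scheme \<Rightarrow> ('r, 'a, 'm) module_scheme \<Rightarrow> ('a \<Rightarrow> 'a) set"
  where "kahler_submodule R A =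
    \<Inter>{N. submodule N A (free_module A (carrier A)) \<and> kahler_relations R A \<subseteq> N}"

definition kahler ::
  "('r, 'k) ring_scheme \<Rightarrow> ('r, 'a, 'm) module_scheme \<Rightarrow> ('a, ('a \<Rightarrow> 'a) set) module"
  where "kahler R A = quotient_module (free_module A (carrier A)) (kahler_submodule R A)"

definition kahler_d ::
  "('r, 'k) ring_scheme \<Rightarrow> ('r, 'a, 'm) module_scheme \<Rightarrow> 'a \<Rightarrow> ('a \<Rightarrow> 'a) set"
  where "kahler_d R A f = kahler_submodule R A +>\<^bsub>free_module A (carrier A)\<^esub> free_gen A f"

definition free_lift ::
  "('a, 'k) ring_scheme \<Rightarrow> ('a, 'b, 'n) module_scheme \<Rightarrow> ('a \<Rightarrow> 'b) \<Rightarrow> ('a \<Rightarrow> 'a) \<Rightarrow> 'b"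
  where "free_lift A M D s = (\<Oplus>\<^bsub>M\<^esub>h\<in>{h. s h \<noteq> \<zero>\<^bsub>A\<^esub>}. s h \<odot>\<^bsub>M\<^esub> D h)"

text \<open>The \<open>A\<close>-linear map \<open>\<Omega>\<^sup>1 \<rightarrow> M\<close> induced by a derivation \<open>D : A \<rightarrow> M\<close>; independence of the
  representative, and the universal property, are proved below.\<close>

definition kahler_lift ::
  "('a, 'k) ring_scheme \<Rightarrow> ('a, 'b, 'n) module_scheme \<Rightarrow> ('a \<Rightarrow> 'b) \<Rightarrow> ('a \<Rightarrow> 'a) set \<Rightarrow> 'b"
  where "kahler_lift A M D \<alpha> = the_elem (free_lift A M D ` \<alpha>)"

text \<open>\<open>anchor A br \<alpha> f\<close> is \<open>\<rho>(\<alpha>)(f)\<close>, where \<open>\<rho>\<close> is the \<open>A\<close>-linear extension of \<open>dh \<mapsto> {h, \<cdot>}\<close>.\<close>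

definition anchor ::
  "('r, 'a, 'm) module_scheme \<Rightarrow> ('a \<Rightarrow> 'a \<Rightarrow> 'a) \<Rightarrow> ('a \<Rightarrow> 'a) set \<Rightarrow> 'a \<Rightarrow> 'a"
  where "anchor A br \<alpha> f = kahler_lift A (regular_module A) (\<lambda>h. br h f) \<alpha>"

section \<open>Admissible Poisson algebras and Poisson triples\<close>

definition semidirect ::
  "('r, 'k) ring_scheme \<Rightarrow> ('r, 'a, 'm) module_scheme \<Rightarrow> ('a, 'b, 'n) module_scheme \<Rightarrow> ('r, 'a \<times> 'b) module"
  where "semidirect R A M =
    \<lparr>carrier = carrier A \<times> carrier M,
     mult = (\<lambda>(f, \<eta>) (g, \<xi>). (f \<otimes>\<^bsub>A\<^esub> g, (f \<odot>\<^bsub>M\<^esub> \<xi>) \<oplus>\<^bsub>M\<^esub> (g \<odot>\<^bsub>M\<^esub> \<eta>))),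
     one = (\<one>\<^bsub>A\<^esub>, \<zero>\<^bsub>M\<^esub>),
     zero = (\<zero>\<^bsub>A\<^esub>, \<zero>\<^bsub>M\<^esub>),
     add = (\<lambda>(f, \<eta>) (g, \<xi>). (f \<oplus>\<^bsub>A\<^esub> g, \<eta> \<oplus>\<^bsub>M\<^esub> \<xi>)),
     smult = (\<lambda>r (f, \<eta>). (r \<odot>\<^bsub>A\<^esub> f, r \<odot>\<^bsub>restrict_scalars R A M\<^esub> \<eta>))\<rparr>"

definition admissible_poisson_algebra ::
  "('r, 'k) ring_scheme \<Rightarrow> ('r, 'a, 'm) module_scheme \<Rightarrow> ('a \<Rightarrow> 'a \<Rightarrow> 'a) \<Rightarrow> ('a, 'b, 'n) module_scheme \<Rightarrow>
   ('a \<times> 'b \<Rightarrow> 'a \<times> 'b \<Rightarrow> 'a \<times> 'b) \<Rightarrow> bool"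
  where "admissible_poisson_algebra R P0 br0 P1 br \<longleftrightarrow>
    poisson_algebra R P0 br0 \<and> faithful_module P0 P1 \<and>
    poisson_structure R (semidirect R P0 P1) br \<and>
    (\<forall>f\<in>carrier P0. \<forall>\<eta>\<in>carrier P1. \<forall>g\<in>carrier P0. \<forall>\<xi>\<in>carrier P1.
       fst (br (f, \<eta>) (g, \<xi>)) = br0 f g)"

definition contravariant_derivative ::
  "('r, 'k) ring_scheme \<Rightarrow> ('r, 'a, 'm) module_scheme \<Rightarrow> ('a \<Rightarrow> 'a \<Rightarrow> 'a) \<Rightarrow> ('a, 'b, 'n) module_scheme \<Rightarrow>
   (('a \<Rightarrow> 'a) set \<Rightarrow> 'b \<Rightarrow> 'b) \<Rightarrow> bool"
  where "contravariant_derivative R P0 br0 P1 D \<longleftrightarrow>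
    bilinear_map R (restrict_scalars R P0 (kahler R P0)) (restrict_scalars R P0 P1)
      (restrict_scalars R P0 P1) D \<and>
    (\<forall>f\<in>carrier P0. \<forall>\<alpha>\<in>carrier (kahler R P0). \<forall>\<eta>\<in>carrier P1.
       D (f \<odot>\<^bsub>kahler R P0\<^esub> \<alpha>) \<eta> = f \<odot>\<^bsub>P1\<^esub> D \<alpha> \<eta>) \<and>
    (\<forall>f\<in>carrier P0. \<forall>\<alpha>\<in>carrier (kahler R P0). \<forall>\<eta>\<in>carrier P1.
       D \<alpha> (f \<odot>\<^bsub>P1\<^esub> \<eta>) = (f \<odot>\<^bsub>P1\<^esub> D \<alpha> \<eta>) \<oplus>\<^bsub>P1\<^esub> (anchor P0 br0 \<alpha> f \<odot>\<^bsub>P1\<^esub> \<eta>))"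

definition corresponding_triple ::
  "('r, 'k) ring_scheme \<Rightarrow> ('r, 'a, 'm) module_scheme \<Rightarrow> ('a \<Rightarrow> 'a \<Rightarrow> 'a) \<Rightarrow> ('a, 'b, 'n) module_scheme \<Rightarrow>
   ('a \<times> 'b \<Rightarrow> 'a \<times> 'b \<Rightarrow> 'a \<times> 'b) \<Rightarrow>
   ('b \<Rightarrow> 'b \<Rightarrow> 'b) \<Rightarrow> (('a \<Rightarrow> 'a) set \<Rightarrow> 'b \<Rightarrow> 'b) \<Rightarrow> (('a \<Rightarrow> 'a) set \<Rightarrow> ('a \<Rightarrow> 'a) set \<Rightarrow> 'b) \<Rightarrow> bool"
  where "corresponding_triple R P0 br0 P1 br br1 D K \<longleftrightarrow>
    lie_bracket P0 P1 br1 \<and>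
    contravariant_derivative R P0 br0 P1 D \<and>
    bilinear_map P0 (kahler R P0) (kahler R P0) P1 K \<and>
    (\<forall>\<alpha>\<in>carrier (kahler R P0). \<forall>\<beta>\<in>carrier (kahler R P0). K \<alpha> \<beta> = \<ominus>\<^bsub>P1\<^esub> K \<beta> \<alpha>) \<and>
    (\<forall>f\<in>carrier P0. \<forall>\<eta>\<in>carrier P1. \<forall>g\<in>carrier P0. \<forall>\<xi>\<in>carrier P1.
       br (f, \<eta>) (g, \<xi>) =
       (br0 f g,
        ((D (kahler_d R P0 f) \<xi> \<ominus>\<^bsub>P1\<^esub> D (kahler_d R P0 g) \<eta>) \<oplus>\<^bsub>P1\<^esub> br1 \<eta> \<xi>)
          \<oplus>\<^bsub>P1\<^esub> K (kahler_d R P0 f) (kahler_d R P0 g)))"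

definition eps :: "('a, 'k) ring_scheme \<Rightarrow> ('a, 'b, 'n) module_scheme \<Rightarrow> ('b \<Rightarrow> 'a) set"
  where "eps A M = {T. linear_map A M (regular_module A) T \<and>
    (\<forall>\<eta>\<in>carrier M. \<forall>\<xi>\<in>carrier M. (T \<xi> \<odot>\<^bsub>M\<^esub> \<eta>) \<oplus>\<^bsub>M\<^esub> (T \<eta> \<odot>\<^bsub>M\<^esub> \<xi>) = \<zero>\<^bsub>M\<^esub>)}"

definition scrT ::
  "('r, 'k) ring_scheme \<Rightarrow> ('r, 'a, 'm) module_scheme \<Rightarrow> ('a, 'b, 'n) module_scheme \<Rightarrow>
   (('a \<Rightarrow> 'a) set \<Rightarrow> 'b \<Rightarrow> 'b) \<Rightarrow> (('a \<Rightarrow> 'a) set \<Rightarrow> ('a \<Rightarrow> 'a) set \<Rightarrow> 'b) \<Rightarrow> 'a \<times> 'b \<Rightarrow> 'a \<Rightarrow> 'b"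
  where "scrT R P0 P1 D K = (\<lambda>(f, \<eta>) g.
    K (kahler_d R P0 f) (kahler_d R P0 g) \<ominus>\<^bsub>P1\<^esub> D (kahler_d R P0 g) \<eta>)"

section \<open>Well-definedness of the constructions\<close>

lemma linear_map_zero_minus:
  assumes "module A M" "module A N" "linear_map A M N T"
  shows "T \<zero>\<^bsub>M\<^esub> = \<zero>\<^bsub>N\<^esub>" "x \<in> carrier M \<Longrightarrow> T (\<ominus>\<^bsub>M\<^esub> x) = \<ominus>\<^bsub>N\<^esub> T x"
proof -
  interpret M: module A M by fact
  interpret N: module A N by fact
  have cl: "x \<in> carrier M \<Longrightarrow> T x \<in> carrier N" for x
    using assms(3) by (auto simp: linear_map_def)
  have sm: "a \<in> carrier A \<Longrightarrow> x \<in> carrier M \<Longrightarrow> T (a \<odot>\<^bsub>M\<^esub> x) = a \<odot>\<^bsub>N\<^esub> T x" for a x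
    using assms(3) by (auto simp: linear_map_def)
  show "T \<zero>\<^bsub>M\<^esub> = \<zero>\<^bsub>N\<^esub>"
    using sm[of "\<zero>\<^bsub>A\<^esub>" "\<zero>\<^bsub>M\<^esub>"] cl by simp
  show "T (\<ominus>\<^bsub>M\<^esub> x) = \<ominus>\<^bsub>N\<^esub> T x" if "x \<in> carrier M"
    using sm[of "\<ominus>\<^bsub>A\<^esub> \<one>\<^bsub>A\<^esub>" x] cl that by (simp add: M.smult_l_minus N.smult_l_minus)
qed

lemma free_module_module:
  fixes S :: "'s set"
  assumes "cring A" shows "module A (free_module A S)"
proof -
  interpret A: cring A by fact
  have fin: "finite {x. s x \<oplus>\<^bsub>A\<^esub> t x \<noteq> \<zero>\<^bsub>A\<^esub>}"
    if "finite {x. s x \<noteq> \<zero>\<^bsub>A\<^esub>}" "finite {x. t x \<noteq> \<zero>\<^bsub>A\<^esub>}" for s t :: "'s \<Rightarrow> 'a"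
    by (rule finite_subset[OF _ finite_UnI[OF that]]) auto
  have mem: "s x \<in> carrier A" if "s \<in> carrier (free_module A S)" for s x
    using that by (cases "x \<in> S") (auto simp: free_module_def)
  have ops: "s \<oplus>\<^bsub>free_module A S\<^esub> t = (\<lambda>x. s x \<oplus>\<^bsub>A\<^esub> t x)"
    "a \<odot>\<^bsub>free_module A S\<^esub> s = (\<lambda>x. a \<otimes>\<^bsub>A\<^esub> s x)" for s t a
    by (simp_all add: free_module_def)
  have neg: "\<exists>t\<in>carrier (free_module A S). t \<oplus>\<^bsub>free_module A S\<^esub> s = \<zero>\<^bsub>free_module A S\<^esub>"
    if s: "s \<in> carrier (free_module A S)" for s
  proof
    have "finite {x. s x \<noteq> \<zero>\<^bsub>A\<^esub>}" using s by (simp add: free_module_def)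
    moreover have "{x. \<ominus>\<^bsub>A\<^esub> s x \<noteq> \<zero>\<^bsub>A\<^esub>} \<subseteq> {x. s x \<noteq> \<zero>\<^bsub>A\<^esub>}" by auto
    ultimately have "finite {x. \<ominus>\<^bsub>A\<^esub> s x \<noteq> \<zero>\<^bsub>A\<^esub>}" by (rule finite_subset[rotated])
    then show "(\<lambda>x. \<ominus>\<^bsub>A\<^esub> s x) \<in> carrier (free_module A S)"
      using s by (auto simp: free_module_def)
    show "(\<lambda>x. \<ominus>\<^bsub>A\<^esub> s x) \<oplus>\<^bsub>free_module A S\<^esub> s = \<zero>\<^bsub>free_module A S\<^esub>"
      using mem[OF s] by (auto simp: free_module_def A.l_neg)
  qed
  show ?thesis
  proof (rule moduleI)
    show "abelian_group (free_module A S)"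
    proof (rule abelian_groupI)
      show "s \<oplus>\<^bsub>free_module A S\<^esub> t \<in> carrier (free_module A S)"
        if "s \<in> carrier (free_module A S)" "t \<in> carrier (free_module A S)" for s t
        using that by (auto simp: free_module_def fin)
      show "\<zero>\<^bsub>free_module A S\<^esub> \<in> carrier (free_module A S)" by (simp add: free_module_def)
      show "x \<oplus>\<^bsub>free_module A S\<^esub> y \<oplus>\<^bsub>free_module A S\<^esub> z =
          x \<oplus>\<^bsub>free_module A S\<^esub> (y \<oplus>\<^bsub>free_module A S\<^esub> z)"
        if "x \<in> carrier (free_module A S)" "y \<in> carrier (free_module A S)"
          "z \<in> carrier (free_module A S)" for x y z
        using that[THEN mem] by (simp add: free_module_def A.a_assoc)
      show "x \<oplus>\<^bsub>free_module A S\<^esub> y = y \<oplus>\<^bsub>free_module A S\<^esub> x"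
        if "x \<in> carrier (free_module A S)" "y \<in> carrier (free_module A S)" for x y
        using that[THEN mem] by (simp add: free_module_def A.a_comm)
      show "\<zero>\<^bsub>free_module A S\<^esub> \<oplus>\<^bsub>free_module A S\<^esub> x = x"
        if "x \<in> carrier (free_module A S)" for x
        using that[THEN mem] by (simp add: free_module_def)
    qed (fact neg)
  next
    fix a s assume a: "a \<in> carrier A" and s: "s \<in> carrier (free_module A S)"
    have "finite {x. s x \<noteq> \<zero>\<^bsub>A\<^esub>}" using s by (simp add: free_module_def)
    moreover have "{x. a \<otimes>\<^bsub>A\<^esub> s x \<noteq> \<zero>\<^bsub>A\<^esub>} \<subseteq> {x. s x \<noteq> \<zero>\<^bsub>A\<^esub>}" using a by auto
    ultimately have "finite {x. a \<otimes>\<^bsub>A\<^esub> s x \<noteq> \<zero>\<^bsub>A\<^esub>}" by (rule finite_subset[rotated])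
    then show "a \<odot>\<^bsub>free_module A S\<^esub> s \<in> carrier (free_module A S)"
      using a s by (auto simp: free_module_def)
  qed (simp_all add: assms ops mem A.l_distr A.r_distr A.m_assoc)
qed

lemma free_gen_closed:
  assumes "cring A" "f \<in> S" shows "free_gen A f \<in> carrier (free_module A S)"
proof -
  interpret cring A by fact
  show ?thesis using assms(2)
    by (auto simp: free_gen_def free_module_def intro: finite_subset[of _ "{f}"])
qed

context
  fixes A :: "('a, 'k) ring_scheme" and M :: "('a, 'b, 'm) module_scheme" and N
  assumes mod: "module A M" and sub: "submodule N A M"
begin

interpretation module A M by (rule mod)

lemma quotient_abelian_subgroup: "abelian_subgroup N M"
  by (rule abelian_subgroupI2[OF M.a_comm_group submodule.axioms(1)[OF sub]])

interpretation N: abelian_subgroup N M by (rule quotient_abelian_subgroup)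

lemma quotient_smult:
  assumes "a \<in> carrier A" "x \<in> carrier M"
  shows "a \<odot>\<^bsub>quotient_module M N\<^esub> (N +>\<^bsub>M\<^esub> x) = N +>\<^bsub>M\<^esub> (a \<odot>\<^bsub>M\<^esub> x)"
proof -
  have "N +>\<^bsub>M\<^esub> (a \<odot>\<^bsub>M\<^esub> y) = N +>\<^bsub>M\<^esub> (a \<odot>\<^bsub>M\<^esub> x)" if y: "y \<in> N +>\<^bsub>M\<^esub> x" for y
  proof -
    obtain n where n: "n \<in> N" "y = n \<oplus>\<^bsub>M\<^esub> x" using y by (auto simp: a_r_coset_def')
    have "a \<odot>\<^bsub>M\<^esub> n \<in> N" by (rule submodule.smult_closed[OF sub assms(1) n(1)])
    moreover have "a \<odot>\<^bsub>M\<^esub> y = a \<odot>\<^bsub>M\<^esub> n \<oplus>\<^bsub>M\<^esub> a \<odot>\<^bsub>M\<^esub> x"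
      using n assms N.a_subset by (simp add: smult_r_distr subset_iff)
    ultimately have "a \<odot>\<^bsub>M\<^esub> y \<in> N +>\<^bsub>M\<^esub> (a \<odot>\<^bsub>M\<^esub> x)" by (auto simp: a_r_coset_def')
    then show ?thesis using assms M.a_repr_independence'[OF _ _ submodule.axioms(1)[OF sub]]
      by (metis a_r_coset_def smult_closed)
  qed
  then have "(\<Union>y\<in>N +>\<^bsub>M\<^esub> x. N +>\<^bsub>M\<^esub> (a \<odot>\<^bsub>M\<^esub> y)) = (\<Union>y\<in>N +>\<^bsub>M\<^esub> x. N +>\<^bsub>M\<^esub> (a \<odot>\<^bsub>M\<^esub> x))"
    by (rule SUP_cong[OF refl])
  also have "\<dots> = N +>\<^bsub>M\<^esub> (a \<odot>\<^bsub>M\<^esub> x)"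
    using N.a_rcos_self[OF assms(2)] by blast
  finally show ?thesis by (simp add: quotient_module_def)
qed

lemma quotient_add:
  assumes "x \<in> carrier M" "y \<in> carrier M"
  shows "(N +>\<^bsub>M\<^esub> x) \<oplus>\<^bsub>quotient_module M N\<^esub> (N +>\<^bsub>M\<^esub> y) = N +>\<^bsub>M\<^esub> (x \<oplus>\<^bsub>M\<^esub> y)"
  using N.a_rcos_sum[OF assms] by (simp add: quotient_module_def)

lemma quotient_carrier: "carrier (quotient_module M N) = (\<lambda>x. N +>\<^bsub>M\<^esub> x) ` carrier M"
  by (auto simp: quotient_module_def A_RCOSETS_def')

lemma quotient_zero: "\<zero>\<^bsub>quotient_module M N\<^esub> = N +>\<^bsub>M\<^esub> \<zero>\<^bsub>M\<^esub>"
  using M.a_coset_add_zero[OF N.a_subset] by (simp add: quotient_module_def)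

lemma quotient_module_module: "module A (quotient_module M N)"
proof (rule moduleI)
  show "abelian_group (quotient_module M N)"
  proof (rule abelian_groupI)
    show "\<exists>y\<in>carrier (quotient_module M N). y \<oplus>\<^bsub>quotient_module M N\<^esub> x = \<zero>\<^bsub>quotient_module M N\<^esub>"
      if x: "x \<in> carrier (quotient_module M N)" for x
    proof -
      obtain m where m: "m \<in> carrier M" "x = N +>\<^bsub>M\<^esub> m" using x by (auto simp: quotient_carrier)
      then show ?thesis
        by (intro bexI[of _ "N +>\<^bsub>M\<^esub> (\<ominus>\<^bsub>M\<^esub> m)"])
          (auto simp: quotient_carrier quotient_add quotient_zero M.l_neg)
    qed
  qed (auto simp: quotient_carrier quotient_add quotient_zero M.a_ac)
qed (auto simp: quotient_carrier quotient_add quotient_zero quotient_smult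
      smult_l_distr smult_r_distr smult_assoc1 R.is_cring)

lemma quotient_linear: "linear_map A M (quotient_module M N) (\<lambda>x. N +>\<^bsub>M\<^esub> x)"
  by (auto simp: linear_map_def quotient_carrier quotient_add quotient_smult)

end

context
  fixes R :: "('r, 'k) ring_scheme" and A :: "('r, 'a, 'm) module_scheme"
  assumes alg: "algebra R A"
begin

interpretation algebra R A by (rule alg)

interpretation F: module A "free_module A (carrier A)"
  by (rule free_module_module) (rule M_cring)

lemma free_gen_F: "f \<in> carrier A \<Longrightarrow> free_gen A f \<in> carrier (free_module A (carrier A))"
  by (rule free_gen_closed[OF M_cring])

lemma kahler_relations_closed: "kahler_relations R A \<subseteq> carrier (free_module A (carrier A))"
  by (auto simp: kahler_relations_def Let_def intro!: F.M.minus_closed F.M.add.m_closed free_gen_F F.smult_closed)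

lemma kahler_submodule: "submodule (kahler_submodule R A) A (free_module A (carrier A))"
proof (rule F.submoduleI)
  show "kahler_submodule R A \<subseteq> carrier (free_module A (carrier A))"
    using F.carrier_is_submodule kahler_relations_closed by (auto simp: kahler_submodule_def)
qed (auto simp: kahler_submodule_def F.submoduleE
     dest: F.submoduleE subgroup.one_closed[OF submodule.axioms(1)])

lemma kahler_module: "module A (kahler R A)"
  unfolding kahler_def by (rule quotient_module_module[OF F.module_axioms kahler_submodule])

lemma kahler_d_closed: "f \<in> carrier A \<Longrightarrow> kahler_d R A f \<in> carrier (kahler R A)"
  unfolding kahler_def kahler_d_def
  by (auto simp: quotient_carrier[OF F.module_axioms kahler_submodule] intro: free_gen_F)

lemma kahler_relation_eq:
  assumes "x \<ominus>\<^bsub>free_module A (carrier A)\<^esub> y \<in> kahler_relations R A"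
    "x \<in> carrier (free_module A (carrier A))" "y \<in> carrier (free_module A (carrier A))"
  shows "kahler_submodule R A +>\<^bsub>free_module A (carrier A)\<^esub> x =
    kahler_submodule R A +>\<^bsub>free_module A (carrier A)\<^esub> y"
proof -
  interpret N: abelian_subgroup "kahler_submodule R A" "free_module A (carrier A)"
    by (rule quotient_abelian_subgroup[OF F.module_axioms kahler_submodule])
  have "x \<ominus>\<^bsub>free_module A (carrier A)\<^esub> y \<in> kahler_submodule R A"
    using assms(1) by (auto simp: kahler_submodule_def)
  then have "x \<in> kahler_submodule R A +>\<^bsub>free_module A (carrier A)\<^esub> y"
    using assms N.a_rcos_module_rev by (simp add: a_minus_def)
  then show ?thesis
    using F.M.a_repr_independence'[OF _ _ submodule.axioms(1)[OF kahler_submodule]] assms(3)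
    by (metis a_r_coset_def)
qed

lemma kahler_d_derivation: "kahler_d R A \<in> Der_into R A (kahler R A)"
proof -
  note q = F.module_axioms kahler_submodule
  have "kahler_d R A (f \<oplus>\<^bsub>A\<^esub> g) = kahler_d R A f \<oplus>\<^bsub>kahler R A\<^esub> kahler_d R A g"
    if "f \<in> carrier A" "g \<in> carrier A" for f g
    unfolding kahler_d_def kahler_def quotient_add[OF q free_gen_F free_gen_F, OF that]
    by (rule kahler_relation_eq) (use that in \<open>auto simp: kahler_relations_def Let_def intro: free_gen_F\<close>)
  moreover have "kahler_d R A (r \<odot>\<^bsub>A\<^esub> f) = (r \<odot>\<^bsub>A\<^esub> \<one>\<^bsub>A\<^esub>) \<odot>\<^bsub>kahler R A\<^esub> kahler_d R A f"
    if "r \<in> carrier R" "f \<in> carrier A" for r f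
    unfolding kahler_d_def kahler_def
      quotient_smult[OF q smult_closed[OF that(1) one_closed] free_gen_F, OF that(2)]
    by (rule kahler_relation_eq) (use that in \<open>auto simp: kahler_relations_def Let_def intro: free_gen_F\<close>)
  moreover have "kahler_d R A (f \<otimes>\<^bsub>A\<^esub> g) = (f \<odot>\<^bsub>kahler R A\<^esub> kahler_d R A g)
      \<oplus>\<^bsub>kahler R A\<^esub> (g \<odot>\<^bsub>kahler R A\<^esub> kahler_d R A f)"
    if "f \<in> carrier A" "g \<in> carrier A" for f g
  proof -
    have c: "f \<odot>\<^bsub>free_module A (carrier A)\<^esub> free_gen A g \<in> carrier (free_module A (carrier A))"
      "g \<odot>\<^bsub>free_module A (carrier A)\<^esub> free_gen A f \<in> carrier (free_module A (carrier A))"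
      using that by (auto intro: free_gen_F)
    show ?thesis
      unfolding kahler_d_def kahler_def
        quotient_smult[OF q that(1) free_gen_F[OF that(2)]]
        quotient_smult[OF q that(2) free_gen_F[OF that(1)]]
        quotient_add[OF q c]
    proof (rule kahler_relation_eq)
      show "free_gen A (f \<otimes>\<^bsub>A\<^esub> g) \<ominus>\<^bsub>free_module A (carrier A)\<^esub>
          (f \<odot>\<^bsub>free_module A (carrier A)\<^esub> free_gen A g
            \<oplus>\<^bsub>free_module A (carrier A)\<^esub> g \<odot>\<^bsub>free_module A (carrier A)\<^esub> free_gen A f)
          \<in> kahler_relations R A"
        using that unfolding kahler_relations_def Let_def by blast
    qed (use that c in \<open>simp_all add: free_gen_F\<close>)
  qed
  ultimately show ?thesis
    by (auto simp: Der_into_def linear_map_def restrict_scalars_def intro: kahler_d_closed)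
qed

context
  fixes M :: "('a, 'b, 'n) module_scheme" and D
  assumes mod: "module A M" and der: "D \<in> Der_into R A M"
begin

interpretation L: module A M by (rule mod)

lemma D_closed: "h \<in> carrier A \<Longrightarrow> D h \<in> carrier M"
  using der by (auto simp: Der_into_def linear_map_def restrict_scalars_def)

lemma free_carrierD:
  assumes "s \<in> carrier (free_module A (carrier A))"
  shows "s h \<in> carrier A" "finite {h. s h \<noteq> \<zero>\<^bsub>A\<^esub>}" "s h \<noteq> \<zero>\<^bsub>A\<^esub> \<Longrightarrow> h \<in> carrier A"
  using assms by (auto simp: free_module_def)

lemma free_lift_superset:
  assumes s: "s \<in> carrier (free_module A (carrier A))"
    and B: "finite B" "B \<subseteq> carrier A" "{h. s h \<noteq> \<zero>\<^bsub>A\<^esub>} \<subseteq> B"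
  shows "free_lift A M D s = (\<Oplus>\<^bsub>M\<^esub>h\<in>B. s h \<odot>\<^bsub>M\<^esub> D h)"
  unfolding free_lift_def
  by (rule L.M.add.finprod_mono_neutral_cong_left)
    (use B free_carrierD[OF s] in \<open>auto intro!: L.smult_closed D_closed simp: D_closed subset_iff\<close>)

lemma free_lift_linear: "linear_map A (free_module A (carrier A)) M (free_lift A M D)"
proof -
  let ?F = "free_module A (carrier A)"
  have cl: "free_lift A M D s \<in> carrier M" if s: "s \<in> carrier ?F" for s
    unfolding free_lift_def using free_carrierD[OF s]
    by (intro L.M.finsum_closed) (auto intro!: L.smult_closed D_closed)
  moreover have "free_lift A M D (s \<oplus>\<^bsub>?F\<^esub> t) = free_lift A M D s \<oplus>\<^bsub>M\<^esub> free_lift A M D t"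
    if s: "s \<in> carrier ?F" and t: "t \<in> carrier ?F" for s t
  proof -
    let ?B = "{h. s h \<noteq> \<zero>\<^bsub>A\<^esub>} \<union> {h. t h \<noteq> \<zero>\<^bsub>A\<^esub>}"
    have B: "finite ?B" "?B \<subseteq> carrier A" using free_carrierD[OF s] free_carrierD[OF t] by auto
    have st: "(s \<oplus>\<^bsub>?F\<^esub> t) h = s h \<oplus>\<^bsub>A\<^esub> t h" for h by (simp add: free_module_def)
    have "free_lift A M D (s \<oplus>\<^bsub>?F\<^esub> t) = (\<Oplus>\<^bsub>M\<^esub>h\<in>?B. (s \<oplus>\<^bsub>?F\<^esub> t) h \<odot>\<^bsub>M\<^esub> D h)"
      by (rule free_lift_superset) (use s t B in \<open>auto simp: st\<close>)
    also have "\<dots> = (\<Oplus>\<^bsub>M\<^esub>h\<in>?B. s h \<odot>\<^bsub>M\<^esub> D h \<oplus>\<^bsub>M\<^esub> t h \<odot>\<^bsub>M\<^esub> D h)"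
      by (rule L.M.add.finprod_cong')
        (use B free_carrierD(1)[OF s] free_carrierD(1)[OF t] in
          \<open>auto simp: st L.smult_l_distr D_closed subset_iff\<close>)
    also have "\<dots> = (\<Oplus>\<^bsub>M\<^esub>h\<in>?B. s h \<odot>\<^bsub>M\<^esub> D h) \<oplus>\<^bsub>M\<^esub> (\<Oplus>\<^bsub>M\<^esub>h\<in>?B. t h \<odot>\<^bsub>M\<^esub> D h)"
      by (rule L.M.finsum_addf)
        (use B free_carrierD(1)[OF s] free_carrierD(1)[OF t] in \<open>auto simp: D_closed subset_iff\<close>)
    also have "\<dots> = free_lift A M D s \<oplus>\<^bsub>M\<^esub> free_lift A M D t"
      using free_lift_superset[OF s B] free_lift_superset[OF t B] by simp
    finally show ?thesis .
  qed
  moreover have "free_lift A M D (a \<odot>\<^bsub>?F\<^esub> s) = a \<odot>\<^bsub>M\<^esub> free_lift A M D s"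
    if a: "a \<in> carrier A" and s: "s \<in> carrier ?F" for a s
  proof -
    let ?B = "{h. s h \<noteq> \<zero>\<^bsub>A\<^esub>}"
    have B: "finite ?B" "?B \<subseteq> carrier A" using free_carrierD[OF s] by auto
    have st: "(a \<odot>\<^bsub>?F\<^esub> s) h = a \<otimes>\<^bsub>A\<^esub> s h" for h by (simp add: free_module_def)
    have "free_lift A M D (a \<odot>\<^bsub>?F\<^esub> s) = (\<Oplus>\<^bsub>M\<^esub>h\<in>?B. (a \<odot>\<^bsub>?F\<^esub> s) h \<odot>\<^bsub>M\<^esub> D h)"
      by (rule free_lift_superset) (use a s B in \<open>auto simp: st\<close>)
    also have "\<dots> = (\<Oplus>\<^bsub>M\<^esub>h\<in>?B. a \<odot>\<^bsub>M\<^esub> (s h \<odot>\<^bsub>M\<^esub> D h))"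
      by (rule L.M.add.finprod_cong')
        (use a B free_carrierD(1)[OF s] in \<open>auto simp: st L.smult_assoc1 D_closed subset_iff\<close>)
    also have "\<dots> = a \<odot>\<^bsub>M\<^esub> free_lift A M D s"
      unfolding free_lift_def by (rule L.finsum_smult_ldistr[symmetric])
        (use a B free_carrierD(1)[OF s] in \<open>auto simp: D_closed subset_iff\<close>)
    finally show ?thesis .
  qed
  ultimately show ?thesis by (auto simp: linear_map_def)
qed

lemma free_lift_gen:
  assumes h: "h \<in> carrier A" shows "free_lift A M D (free_gen A h) = D h"
proof -
  have "free_lift A M D (free_gen A h) = (\<Oplus>\<^bsub>M\<^esub>k\<in>{h}. free_gen A h k \<odot>\<^bsub>M\<^esub> D k)"
    by (rule free_lift_superset) (use h in \<open>auto simp: free_gen_def intro!: free_gen_F[unfolded free_gen_def]\<close>)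
  then show ?thesis using h by (simp add: free_gen_def D_closed)
qed

lemma free_lift_kahler_submodule:
  assumes "s \<in> kahler_submodule R A" shows "free_lift A M D s = \<zero>\<^bsub>M\<^esub>"
proof -
  let ?F = "free_module A (carrier A)" and ?L = "free_lift A M D"
  have cl: "x \<in> carrier ?F \<Longrightarrow> ?L x \<in> carrier M"
    and add: "x \<in> carrier ?F \<Longrightarrow> y \<in> carrier ?F \<Longrightarrow> ?L (x \<oplus>\<^bsub>?F\<^esub> y) = ?L x \<oplus>\<^bsub>M\<^esub> ?L y"
    and sm: "a \<in> carrier A \<Longrightarrow> x \<in> carrier ?F \<Longrightarrow> ?L (a \<odot>\<^bsub>?F\<^esub> x) = a \<odot>\<^bsub>M\<^esub> ?L x" for x y a
    using free_lift_linear by (auto simp: linear_map_def)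
  note lin = linear_map_zero_minus[OF F.module_axioms mod free_lift_linear]
  have "submodule {x \<in> carrier ?F. ?L x = \<zero>\<^bsub>M\<^esub>} A ?F"
    by (rule F.submoduleI) (auto simp: add sm lin)
  moreover have rel: "?L (x \<ominus>\<^bsub>?F\<^esub> y) = \<zero>\<^bsub>M\<^esub>"
    if "x \<in> carrier ?F" "y \<in> carrier ?F" "?L x = ?L y" for x y
    using that by (simp add: a_minus_def add lin cl L.M.r_neg)
  have "kahler_relations R A \<subseteq> {x \<in> carrier ?F. ?L x = \<zero>\<^bsub>M\<^esub>}"
  proof -
    have "D (f \<oplus>\<^bsub>A\<^esub> g) = D f \<oplus>\<^bsub>M\<^esub> D g" "D (f \<otimes>\<^bsub>A\<^esub> g) = (f \<odot>\<^bsub>M\<^esub> D g) \<oplus>\<^bsub>M\<^esub> (g \<odot>\<^bsub>M\<^esub> D f)"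
      if "f \<in> carrier A" "g \<in> carrier A" for f g
      using der that by (auto simp: Der_into_def linear_map_def restrict_scalars_def)
    moreover have "D (r \<odot>\<^bsub>A\<^esub> f) = (r \<odot>\<^bsub>A\<^esub> \<one>\<^bsub>A\<^esub>) \<odot>\<^bsub>M\<^esub> D f"
      if "r \<in> carrier R" "f \<in> carrier A" for r f
      using der that by (auto simp: Der_into_def linear_map_def restrict_scalars_def)
    ultimately have "kahler_relations R A \<subseteq> {x. ?L x = \<zero>\<^bsub>M\<^esub>}"
      by (auto simp: kahler_relations_def Let_def free_gen_F free_lift_gen add sm intro!: rel)
    then show ?thesis using kahler_relations_closed by auto
  qed
  ultimately have "kahler_submodule R A \<subseteq> {x \<in> carrier ?F. ?L x = \<zero>\<^bsub>M\<^esub>}"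
    unfolding kahler_submodule_def by blast
  then show ?thesis using assms by auto
qed

lemma kahler_lift_coset:
  assumes s: "s \<in> carrier (free_module A (carrier A))"
  shows "kahler_lift A M D (kahler_submodule R A +>\<^bsub>free_module A (carrier A)\<^esub> s) = free_lift A M D s"
proof -
  let ?F = "free_module A (carrier A)" and ?L = "free_lift A M D"
  have "?L (n \<oplus>\<^bsub>?F\<^esub> s) = ?L s" if "n \<in> kahler_submodule R A" for n
    using free_lift_linear s that F.submoduleE(1)[OF kahler_submodule] free_lift_kahler_submodule[OF that]
    by (auto simp: linear_map_def subset_iff Pi_iff)
  moreover have "kahler_submodule R A \<noteq> {}" by (rule F.submoduleE(2)[OF kahler_submodule])
  ultimately have "?L ` (kahler_submodule R A +>\<^bsub>?F\<^esub> s) = {?L s}"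
    by (simp add: a_r_coset_def' image_UN)
  then show ?thesis by (simp add: kahler_lift_def)
qed

lemma kahler_lift_linear: "linear_map A (kahler R A) M (kahler_lift A M D)"
proof -
  note q = F.module_axioms kahler_submodule
  show ?thesis using free_lift_linear
    by (auto simp: linear_map_def kahler_def quotient_carrier[OF q] quotient_add[OF q]
        quotient_smult[OF q] kahler_lift_coset)
qed

lemma kahler_lift_d: "h \<in> carrier A \<Longrightarrow> kahler_lift A M D (kahler_d R A h) = D h"
  by (simp add: kahler_d_def kahler_lift_coset free_gen_F free_lift_gen)

end

lemma free_module_induct:
  assumes s: "s \<in> carrier (free_module A (carrier A))"
    and sub: "submodule H A (free_module A (carrier A))"
    and gen: "\<And>h. h \<in> carrier A \<Longrightarrow> free_gen A h \<in> H"
  shows "s \<in> H"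
proof -
  let ?F = "free_module A (carrier A)"
  have "\<forall>s\<in>carrier ?F. {h. s h \<noteq> \<zero>\<^bsub>A\<^esub>} \<subseteq> B \<longrightarrow> s \<in> H" if "finite B" for B
    using that
  proof induction
    case empty
    have "\<zero>\<^bsub>?F\<^esub> \<in> H" using subgroup.one_closed[OF submodule.axioms(1)[OF sub]] by simp
    then have "(\<lambda>_. \<zero>\<^bsub>A\<^esub>) \<in> H" by (simp add: free_module_def)
    moreover have "s = (\<lambda>_. \<zero>\<^bsub>A\<^esub>)" if "{h. s h \<noteq> \<zero>\<^bsub>A\<^esub>} \<subseteq> {}" for s :: "'a \<Rightarrow> 'a"
      using that by auto
    ultimately show ?case by metis
  next
    case (insert b B)
    show ?case
    proof (intro ballI impI)
      fix s assume s: "s \<in> carrier ?F" and sB: "{h. s h \<noteq> \<zero>\<^bsub>A\<^esub>} \<subseteq> insert b B"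
      have sc: "s h \<in> carrier A" for h using s by (cases "h \<in> carrier A") (auto simp: free_module_def)
      show "s \<in> H"
      proof (cases "s b = \<zero>\<^bsub>A\<^esub>")
        case True
        then have "{h. s h \<noteq> \<zero>\<^bsub>A\<^esub>} \<subseteq> B" using sB by auto
        then show ?thesis using insert.IH s by blast
      next
        case False
        then have b: "b \<in> carrier A" using s by (auto simp: free_module_def)
        define t where "t = s(b := \<zero>\<^bsub>A\<^esub>)"
        have "{h. t h \<noteq> \<zero>\<^bsub>A\<^esub>} \<subseteq> {h. s h \<noteq> \<zero>\<^bsub>A\<^esub>}" by (auto simp: t_def)
        then have "t \<in> carrier ?F"
          using s b unfolding free_module_def t_def by (auto intro: finite_subset)
        moreover have "{h. t h \<noteq> \<zero>\<^bsub>A\<^esub>} \<subseteq> B" using sB by (auto simp: t_def)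
        ultimately have "t \<in> H" using insert.IH by blast
        moreover have "s b \<odot>\<^bsub>?F\<^esub> free_gen A b \<in> H"
          by (rule submodule.smult_closed[OF sub sc gen[OF b]])
        moreover have "s = t \<oplus>\<^bsub>?F\<^esub> (s b \<odot>\<^bsub>?F\<^esub> free_gen A b)"
          using sc by (auto simp: fun_eq_iff t_def free_module_def free_gen_def)
        ultimately show ?thesis using F.submoduleE(5)[OF sub] by metis
      qed
    qed
  qed
  moreover have "finite {h. s h \<noteq> \<zero>\<^bsub>A\<^esub>}" using s by (simp add: free_module_def)
  ultimately show ?thesis using s by blast
qed

lemma kahler_generated:
  assumes sub: "submodule H A (kahler R A)" and gen: "\<And>h. h \<in> carrier A \<Longrightarrow> kahler_d R A h \<in> H"
  shows "H = carrier (kahler R A)"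
proof -
  let ?F = "free_module A (carrier A)" and ?q = "\<lambda>s. kahler_submodule R A +>\<^bsub>free_module A (carrier A)\<^esub> s"
  note q = F.module_axioms kahler_submodule
  interpret K: module A "kahler R A" by (rule kahler_module)
  have lin: "linear_map A ?F (kahler R A) ?q" unfolding kahler_def by (rule quotient_linear[OF q])
  note zm = linear_map_zero_minus[OF F.module_axioms K.module_axioms lin]
  have sm: "submodule {s \<in> carrier ?F. ?q s \<in> H} A ?F"
    by (rule F.submoduleI)
      (use K.submoduleE[OF sub] subgroup.one_closed[OF submodule.axioms(1)[OF sub]] lin in
        \<open>auto simp: zm linear_map_def\<close>)
  have "s \<in> {s \<in> carrier ?F. ?q s \<in> H}" if "s \<in> carrier ?F" for s
    by (rule free_module_induct[OF that sm]) (use gen in \<open>auto simp: free_gen_F kahler_d_def\<close>)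
  then have "carrier (kahler R A) \<subseteq> H" by (auto simp: kahler_def quotient_carrier[OF q])
  then show ?thesis using K.submoduleE(1)[OF sub] by blast
qed

theorem kahler_universal:
  assumes mod: "module A M" and der: "D \<in> Der_into R A M"
  shows "linear_map A (kahler R A) M (kahler_lift A M D)"
    and "\<forall>h\<in>carrier A. kahler_lift A M D (kahler_d R A h) = D h"
    and "linear_map A (kahler R A) M T \<Longrightarrow> \<forall>h\<in>carrier A. T (kahler_d R A h) = D h \<Longrightarrow>
      \<alpha> \<in> carrier (kahler R A) \<Longrightarrow> T \<alpha> = kahler_lift A M D \<alpha>"
proof -
  show L: "linear_map A (kahler R A) M (kahler_lift A M D)" by (rule kahler_lift_linear[OF assms])
  show Ld: "\<forall>h\<in>carrier A. kahler_lift A M D (kahler_d R A h) = D h"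
    using kahler_lift_d[OF assms] by blast
  assume T: "linear_map A (kahler R A) M T" and Td: "\<forall>h\<in>carrier A. T (kahler_d R A h) = D h"
    and \<alpha>: "\<alpha> \<in> carrier (kahler R A)"
  interpret M: module A M by (rule mod)
  interpret K: module A "kahler R A" by (rule kahler_module)
  have "submodule {\<alpha> \<in> carrier (kahler R A). T \<alpha> = kahler_lift A M D \<alpha>} A (kahler R A)"
    by (rule K.submoduleI)
      (use L T linear_map_zero_minus[OF K.module_axioms mod L]
         linear_map_zero_minus[OF K.module_axioms mod T] in \<open>auto simp: linear_map_def\<close>)
  then have "{\<alpha> \<in> carrier (kahler R A). T \<alpha> = kahler_lift A M D \<alpha>} = carrier (kahler R A)"
    by (rule kahler_generated) (auto simp: Ld Td kahler_d_closed)
  then show "T \<alpha> = kahler_lift A M D \<alpha>" using \<alpha> by auto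
qed

lemma regular_module_module: "module A (regular_module A)"
proof (rule moduleI)
  show "abelian_group (regular_module A)"
    by (rule abelian_groupI)
      (auto simp: regular_module_def M.a_ac intro: bexI[of _ "\<ominus>\<^bsub>A\<^esub> _"] M.l_neg)
qed (auto simp: regular_module_def l_distr r_distr m_assoc M_cring)

lemma Der_regular_module: "Der R A = Der_into R A (regular_module A)"
proof -
  have sm: "(r \<odot>\<^bsub>A\<^esub> \<one>\<^bsub>A\<^esub>) \<otimes>\<^bsub>A\<^esub> x = r \<odot>\<^bsub>A\<^esub> x" if "r \<in> carrier R" "x \<in> carrier A" for r x
    using that by (simp add: smult_assoc2)
  have lz: "D f \<otimes>\<^bsub>A\<^esub> g \<oplus>\<^bsub>A\<^esub> f \<otimes>\<^bsub>A\<^esub> D g = f \<otimes>\<^bsub>A\<^esub> D g \<oplus>\<^bsub>A\<^esub> g \<otimes>\<^bsub>A\<^esub> D f"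
    if "f \<in> carrier A" "g \<in> carrier A" "D \<in> carrier A \<rightarrow> carrier A" for f g D
    using that by (simp add: Pi_iff m_comm[of "D f" g] M.a_comm)
  have "linear_map R A A D \<longleftrightarrow> linear_map R A (restrict_scalars R A (regular_module A)) D" for D
    by (auto simp: linear_map_def restrict_scalars_def regular_module_def sm Pi_iff)
  moreover have "linear_map R A A D \<Longrightarrow> D \<in> carrier A \<rightarrow> carrier A" for D
    by (simp add: linear_map_def)
  ultimately show ?thesis
    by (auto simp: Der_def Der_into_def regular_module_def lz)
qed

lemma anchor_linear:
  assumes "poisson_algebra R A br" and f: "f \<in> carrier A"
  shows "linear_map A (kahler R A) (regular_module A) (\<lambda>\<alpha>. anchor A br \<alpha> f)"
    and "h \<in> carrier A \<Longrightarrow> anchor A br (kahler_d R A h) f = br h f"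
proof -
  have "(\<lambda>h. br h f) \<in> Der R A"
    using assms by (auto simp: poisson_algebra_def poisson_structure_def)
  note u = kahler_universal[OF regular_module_module this[unfolded Der_regular_module]]
  show "linear_map A (kahler R A) (regular_module A) (\<lambda>\<alpha>. anchor A br \<alpha> f)"
    using u(1) by (simp add: anchor_def)
  show "h \<in> carrier A \<Longrightarrow> anchor A br (kahler_d R A h) f = br h f"
    using u(2) by (simp add: anchor_def)
qed

lemma semidirect_algebra:
  assumes "module A M" shows "algebra R (semidirect R A M)"
proof -
  interpret L: module A M by fact
  have sc: "r \<odot>\<^bsub>A\<^esub> x = (r \<odot>\<^bsub>A\<^esub> \<one>\<^bsub>A\<^esub>) \<otimes>\<^bsub>A\<^esub> x" if "r \<in> carrier R" "x \<in> carrier A" for r x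
    using that by (simp add: smult_assoc2)
  have c: "cring (semidirect R A M)"
  proof (rule cringI)
    show "abelian_group (semidirect R A M)"
    proof (rule abelian_groupI)
      show "\<exists>y\<in>carrier (semidirect R A M). y \<oplus>\<^bsub>semidirect R A M\<^esub> x = \<zero>\<^bsub>semidirect R A M\<^esub>"
        if "x \<in> carrier (semidirect R A M)" for x
        using that by (intro bexI[of _ "(\<ominus>\<^bsub>A\<^esub> fst x, \<ominus>\<^bsub>M\<^esub> snd x)"])
          (auto simp: semidirect_def M.l_neg L.M.l_neg)
    qed (auto simp: semidirect_def M.a_ac L.M.a_ac)
    show "comm_monoid (semidirect R A M)"
      by (rule comm_monoidI)
        (auto simp: semidirect_def m_ac L.M.a_ac L.smult_r_distr L.smult_assoc1[symmetric])
  qed (auto simp: semidirect_def l_distr L.smult_l_distr L.smult_r_distr L.M.a_ac)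
  have e: "((r \<otimes>\<^bsub>R\<^esub> s) \<odot>\<^bsub>A\<^esub> \<one>\<^bsub>A\<^esub>) = (r \<odot>\<^bsub>A\<^esub> \<one>\<^bsub>A\<^esub>) \<otimes>\<^bsub>A\<^esub> (s \<odot>\<^bsub>A\<^esub> \<one>\<^bsub>A\<^esub>)"
    if "r \<in> carrier R" "s \<in> carrier R" for r s
    using that by (simp add: smult_assoc1 smult_assoc2)
  have h: "(r \<odot>\<^bsub>A\<^esub> x) \<odot>\<^bsub>M\<^esub> \<xi> = (r \<odot>\<^bsub>A\<^esub> \<one>\<^bsub>A\<^esub>) \<odot>\<^bsub>M\<^esub> (x \<odot>\<^bsub>M\<^esub> \<xi>)"
    if "r \<in> carrier R" "x \<in> carrier A" "\<xi> \<in> carrier M" for r x \<xi>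
    using that by (subst sc) (auto simp: L.smult_assoc1)
  have k: "y \<odot>\<^bsub>M\<^esub> (x \<odot>\<^bsub>M\<^esub> \<xi>) = x \<odot>\<^bsub>M\<^esub> (y \<odot>\<^bsub>M\<^esub> \<xi>)"
    if "y \<in> carrier A" "x \<in> carrier A" "\<xi> \<in> carrier M" for y x \<xi>
    using that by (metis L.smult_assoc1 m_comm)
  show ?thesis
  proof (rule algebraI[OF R_cring c])
    fix r x y
    assume r: "r \<in> carrier R" and "x \<in> carrier (semidirect R A M)" "y \<in> carrier (semidirect R A M)"
    then obtain f \<eta> g \<xi> where xy: "x = (f, \<eta>)" "y = (g, \<xi>)"
      and m: "f \<in> carrier A" "\<eta> \<in> carrier M" "g \<in> carrier A" "\<xi> \<in> carrier M"
      by (auto simp: semidirect_def)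
    have r1: "r \<odot>\<^bsub>A\<^esub> \<one>\<^bsub>A\<^esub> \<in> carrier A" using r by simp
    show "(r \<odot>\<^bsub>semidirect R A M\<^esub> x) \<otimes>\<^bsub>semidirect R A M\<^esub> y =
        r \<odot>\<^bsub>semidirect R A M\<^esub> (x \<otimes>\<^bsub>semidirect R A M\<^esub> y)"
      using r m r1
      by (simp add: xy semidirect_def restrict_scalars_def smult_assoc2 L.smult_r_distr
          k[OF m(3) r1 m(2)] h[OF r m(1,4)])
  next
    fix r s x assume "r \<in> carrier R" "s \<in> carrier R" "x \<in> carrier (semidirect R A M)"
    then show "(r \<otimes>\<^bsub>R\<^esub> s) \<odot>\<^bsub>semidirect R A M\<^esub> x =
        r \<odot>\<^bsub>semidirect R A M\<^esub> (s \<odot>\<^bsub>semidirect R A M\<^esub> x)"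
      by (auto simp: semidirect_def restrict_scalars_def e L.smult_assoc1) (simp add: smult_assoc1)
  qed (auto simp: semidirect_def restrict_scalars_def smult_l_distr smult_r_distr
         L.smult_l_distr L.smult_r_distr)
qed

end

end

theory Submission
  imports Defs
begin

text \<open>Both the product and the bracket of \<open>P\<close> are biadditive, and they are commutative and
  skew-symmetric respectively, so the Leibniz rule for \<open>X\<close> need only be tested on pairs of
  homogeneous elements \<open>(f, 0)\<close>, \<open>(0, \<eta>)\<close>. For the product these tests are the hypotheses on
  the components of \<open>X\<close>; for the bracket the pairs \<open>(f, 0), (g, 0)\<close> give the first and third
  equations, \<open>(f, 0), (0, \<xi>)\<close> the fourth and sixth, and \<open>(0, \<eta>), (0, \<xi>)\<close> the second and fifth.\<close>

section \<open>Zero, closure and sign rules for additive and bilinear maps and for Lie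
  brackets\<close>

lemma additive_zero:
  assumes "abelian_group M" "abelian_group N" "T \<in> carrier M \<rightarrow> carrier N"
    and add: "\<And>x y. x \<in> carrier M \<Longrightarrow> y \<in> carrier M \<Longrightarrow> T (x \<oplus>\<^bsub>M\<^esub> y) = T x \<oplus>\<^bsub>N\<^esub> T y"
  shows "T \<zero>\<^bsub>M\<^esub> = \<zero>\<^bsub>N\<^esub>"
proof -
  interpret M: abelian_group M by fact
  interpret N: abelian_group N by fact
  have "T \<zero>\<^bsub>M\<^esub> \<oplus>\<^bsub>N\<^esub> T \<zero>\<^bsub>M\<^esub> = T \<zero>\<^bsub>M\<^esub>" using add[of "\<zero>\<^bsub>M\<^esub>" "\<zero>\<^bsub>M\<^esub>"] by simp
  moreover have "T \<zero>\<^bsub>M\<^esub> \<in> carrier N" using assms(3) by auto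
  ultimately show ?thesis using N.add.r_cancel_one' by metis
qed

text \<open>Only abelian groups are required, in contrast to \<open>linear_map_zero_minus\<close>:
  modules formed by \<open>restrict_scalars\<close> are handled below through their additive groups
  alone.\<close>

lemma linear_map_zero:
  assumes "abelian_group M" "abelian_group N" "linear_map R M N T"
  shows "T \<zero>\<^bsub>M\<^esub> = \<zero>\<^bsub>N\<^esub>"
  by (rule additive_zero[OF assms(1,2)]) (use assms(3) in \<open>auto simp: linear_map_def\<close>)

lemma bilinear_map_zero:
  assumes "abelian_group M" "abelian_group N" "abelian_group L" and B: "bilinear_map R M N L B"
  shows "x \<in> carrier M \<Longrightarrow> B x \<zero>\<^bsub>N\<^esub> = \<zero>\<^bsub>L\<^esub>" "y \<in> carrier N \<Longrightarrow> B \<zero>\<^bsub>M\<^esub> y = \<zero>\<^bsub>L\<^esub>"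
  using linear_map_zero[OF assms(2,3), of R "B x"]
    linear_map_zero[OF assms(1,3), of R "\<lambda>x. B x y"] B
  by (auto simp: bilinear_map_def)

lemma bilinear_map_closed:
  "bilinear_map R M N L B \<Longrightarrow> x \<in> carrier M \<Longrightarrow> y \<in> carrier N \<Longrightarrow> B x y \<in> carrier L"
  by (auto simp: bilinear_map_def linear_map_def)

lemma bilinear_map_add:
  assumes "bilinear_map R M N L B"
  shows "x \<in> carrier M \<Longrightarrow> x' \<in> carrier M \<Longrightarrow> y \<in> carrier N \<Longrightarrow>
      B (x \<oplus>\<^bsub>M\<^esub> x') y = B x y \<oplus>\<^bsub>L\<^esub> B x' y"
    and "x \<in> carrier M \<Longrightarrow> y \<in> carrier N \<Longrightarrow> y' \<in> carrier N \<Longrightarrow>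
      B x (y \<oplus>\<^bsub>N\<^esub> y') = B x y \<oplus>\<^bsub>L\<^esub> B x y'"
  using assms by (auto simp: bilinear_map_def linear_map_def)

lemma restrict_scalars_abelian_group:
  assumes "abelian_group M" shows "abelian_group (restrict_scalars R A M)"
proof -
  interpret abelian_group M by fact
  show ?thesis
    by (rule abelian_groupI) (auto simp: restrict_scalars_def a_ac intro: bexI[of _ "\<ominus>\<^bsub>M\<^esub> _"] l_neg)
qed

lemma restrict_scalars_simps:
  "carrier (restrict_scalars R A M) = carrier M" "\<zero>\<^bsub>restrict_scalars R A M\<^esub> = \<zero>\<^bsub>M\<^esub>"
  by (simp_all add: restrict_scalars_def)

text \<open>Polarisation: expand the vanishing bracket of \<open>x + y\<close> with itself. The
  definition of \<open>lie_bracket\<close> gives the alternating law, whereas the reduction to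
  generators needs a sign rule for exchanging arguments.\<close>

lemma lie_bracket_skew:
  assumes "abelian_group M" "lie_bracket R M br" and xy: "x \<in> carrier M" "y \<in> carrier M"
  shows "br x y = \<ominus>\<^bsub>M\<^esub> br y x"
proof -
  interpret abelian_group M by fact
  have bil: "bilinear_map R M M M br" and alt: "\<And>x. x \<in> carrier M \<Longrightarrow> br x x = \<zero>\<^bsub>M\<^esub>"
    using assms(2) by (auto simp: lie_bracket_def)
  have "br (x \<oplus>\<^bsub>M\<^esub> y) (x \<oplus>\<^bsub>M\<^esub> y) = (br x x \<oplus>\<^bsub>M\<^esub> br y x) \<oplus>\<^bsub>M\<^esub> (br x y \<oplus>\<^bsub>M\<^esub> br y y)"
    using xy by (simp add: bilinear_map_add[OF bil] bilinear_map_closed[OF bil])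
  then have "br x y \<oplus>\<^bsub>M\<^esub> br y x = \<zero>\<^bsub>M\<^esub>" using alt xy by (simp add: bilinear_map_closed[OF bil] a_comm)
  then show ?thesis using xy by (metis bilinear_map_closed[OF bil] minus_equality)
qed

section \<open>The Leibniz rule tested on additive generators\<close>

definition leibniz_at ::
  "('a, 'k) ring_scheme \<Rightarrow> ('a \<Rightarrow> 'a \<Rightarrow> 'a) \<Rightarrow> ('a \<Rightarrow> 'a) \<Rightarrow> 'a \<Rightarrow> 'a \<Rightarrow> bool"
  where "leibniz_at G B X x y \<longleftrightarrow> X (B x y) = B (X x) y \<oplus>\<^bsub>G\<^esub> B x (X y)"

text \<open>Common setting for the product of \<open>P\<close> and its bracket, which is why
  \<open>leibniz_at\<close> takes only the addition from \<open>G\<close> and leaves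
  \<open>B\<close> free. The two cases of \<open>symm\<close> are the commutative product and the
  skew bracket; with either one, additivity of \<open>B\<close> in the left argument
  suffices.\<close>

locale additive_on_biadditive = abelian_group G for G (structure) +
  fixes B :: "'a \<Rightarrow> 'a \<Rightarrow> 'a" and X :: "'a \<Rightarrow> 'a"
  assumes B_closed [simp]: "x \<in> carrier G \<Longrightarrow> y \<in> carrier G \<Longrightarrow> B x y \<in> carrier G"
    and B_add_left: "x \<in> carrier G \<Longrightarrow> x' \<in> carrier G \<Longrightarrow> y \<in> carrier G \<Longrightarrow> B (x \<oplus> x') y = B x y \<oplus> B x' y"
    and X_closed [simp]: "x \<in> carrier G \<Longrightarrow> X x \<in> carrier G"
    and X_add: "x \<in> carrier G \<Longrightarrow> y \<in> carrier G \<Longrightarrow> X (x \<oplus> y) = X x \<oplus> X y"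
    and symm: "(\<forall>x\<in>carrier G. \<forall>y\<in>carrier G. B x y = B y x) \<or>
      (\<forall>x\<in>carrier G. \<forall>y\<in>carrier G. B x y = \<ominus> B y x)"
begin

lemma leibniz_at_add_left:
  assumes "x \<in> carrier G" "x' \<in> carrier G" "y \<in> carrier G"
    and "leibniz_at G B X x y" "leibniz_at G B X x' y"
  shows "leibniz_at G B X (x \<oplus> x') y"
  using assms by (simp add: leibniz_at_def B_add_left X_add a_ac)

lemma X_minus: "x \<in> carrier G \<Longrightarrow> X (\<ominus> x) = \<ominus> X x"
proof -
  assume x: "x \<in> carrier G"
  have "X \<zero> = \<zero>"
    by (rule additive_zero) (auto simp: X_add abelian_group_axioms)
  then have "X (\<ominus> x) \<oplus> X x = \<zero>" using x X_add[of "\<ominus> x" x] by (simp add: l_neg)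
  then show ?thesis using x by (simp add: minus_equality)
qed

text \<open>In the commutative case the two identities agree up to the order of summands. In the
  skew case all three terms change sign, which is where \<open>X_minus\<close> enters.\<close>

lemma leibniz_at_swap:
  assumes xy: "x \<in> carrier G" "y \<in> carrier G" and L: "leibniz_at G B X x y"
  shows "leibniz_at G B X y x"
  using symm
proof
  assume c: "\<forall>x\<in>carrier G. \<forall>y\<in>carrier G. B x y = B y x"
  then have "B y x = B x y" "B (X y) x = B x (X y)" "B y (X x) = B (X x) y"
    using xy by (simp_all only: X_closed)
  with L xy show ?thesis by (simp add: leibniz_at_def a_comm)
next
  assume c: "\<forall>x\<in>carrier G. \<forall>y\<in>carrier G. B x y = \<ominus> B y x"
  have "B y x = \<ominus> B x y" "B (X y) x = \<ominus> B x (X y)" "B y (X x) = \<ominus> B (X x) y"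
    using c xy X_closed by blast+
  with L xy show ?thesis by (simp add: leibniz_at_def a_comm X_minus minus_add)
qed

text \<open>The Leibniz defect is additive in the left argument, so that argument is decomposed
  first, against a fixed generator. A swap then brings the other argument to the left.\<close>

lemma leibniz_at_generators:
  assumes "U \<subseteq> carrier G" "V \<subseteq> carrier G"
    and gen: "\<And>x. x \<in> carrier G \<Longrightarrow> \<exists>u\<in>U. \<exists>v\<in>V. x = u \<oplus> v"
  shows "(\<forall>x\<in>carrier G. \<forall>y\<in>carrier G. leibniz_at G B X x y) \<longleftrightarrow>
    (\<forall>u\<in>U. \<forall>u'\<in>U. leibniz_at G B X u u') \<and> (\<forall>u\<in>U. \<forall>v\<in>V. leibniz_at G B X u v) \<and>
    (\<forall>v\<in>V. \<forall>v'\<in>V. leibniz_at G B X v v')" (is "?all \<longleftrightarrow> ?gen")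
proof
  show "?all \<Longrightarrow> ?gen" using assms(1,2) by blast
next
  assume g: ?gen
  have left: "leibniz_at G B X x w" if x: "x \<in> carrier G" and w: "w \<in> U \<union> V" for x w
  proof -
    obtain u v where uv: "u \<in> U" "v \<in> V" "x = u \<oplus> v" using gen[OF x] by blast
    have c: "u \<in> carrier G" "v \<in> carrier G" "w \<in> carrier G" using uv w assms(1,2) by auto
    have "leibniz_at G B X u w" using g uv w by blast
    moreover have "leibniz_at G B X v w" using g uv w leibniz_at_swap[OF c(3,2)] by blast
    ultimately show ?thesis using leibniz_at_add_left c uv(3) by simp
  qed
  show ?all
  proof (intro ballI)
    fix x y assume x: "x \<in> carrier G" and y: "y \<in> carrier G"
    obtain u v where uv: "u \<in> U" "v \<in> V" "y = u \<oplus> v" using gen[OF y] by blast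
    have c: "u \<in> carrier G" "v \<in> carrier G" using uv assms(1,2) by auto
    have "leibniz_at G B X y x"
      unfolding uv(3) using uv x c left
      by (intro leibniz_at_add_left leibniz_at_swap[of x]) auto
    then show "leibniz_at G B X x y" using leibniz_at_swap x y by blast
  qed
qed

end

lemma linear_map_additive_on_biadditive:
  assumes "abelian_group G" "linear_map R G G X" "bilinear_map R G G G B"
    and "(\<forall>x\<in>carrier G. \<forall>y\<in>carrier G. B x y = B y x) \<or>
      (\<forall>x\<in>carrier G. \<forall>y\<in>carrier G. B x y = \<ominus>\<^bsub>G\<^esub> B y x)"
  shows "additive_on_biadditive G B X"
proof -
  interpret abelian_group G by fact
  show ?thesis
    by unfold_locales
      (use assms(2) in \<open>auto simp: linear_map_def bilinear_map_closed[OF assms(3)]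
        bilinear_map_add[OF assms(3)] intro!: assms(4)\<close>)
qed

section \<open>The semidirect product and its homogeneous elements\<close>

lemma semidirect_simps:
  "carrier (semidirect R A M) = carrier A \<times> carrier M"
  "(f, \<eta>) \<otimes>\<^bsub>semidirect R A M\<^esub> (g, \<xi>) = (f \<otimes>\<^bsub>A\<^esub> g, (f \<odot>\<^bsub>M\<^esub> \<xi>) \<oplus>\<^bsub>M\<^esub> (g \<odot>\<^bsub>M\<^esub> \<eta>))"
  "(f, \<eta>) \<oplus>\<^bsub>semidirect R A M\<^esub> (g, \<xi>) = (f \<oplus>\<^bsub>A\<^esub> g, \<eta> \<oplus>\<^bsub>M\<^esub> \<xi>)"
  by (simp_all add: semidirect_def)

text \<open>The generators are the two summands of \<open>P\<close>, since
  \<open>(f, \<eta>)\<close> is the sum of \<open>(f, 0)\<close> and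
  \<open>(0, \<eta>)\<close>.\<close>

lemma semidirect_leibniz_iff:
  assumes "abelian_group A" "abelian_group M" and add: "additive_on_biadditive (semidirect R A M) B X"
  shows "(\<forall>x\<in>carrier (semidirect R A M). \<forall>y\<in>carrier (semidirect R A M).
      leibniz_at (semidirect R A M) B X x y) \<longleftrightarrow>
    (\<forall>f\<in>carrier A. \<forall>g\<in>carrier A. leibniz_at (semidirect R A M) B X (f, \<zero>\<^bsub>M\<^esub>) (g, \<zero>\<^bsub>M\<^esub>)) \<and>
    (\<forall>f\<in>carrier A. \<forall>\<xi>\<in>carrier M. leibniz_at (semidirect R A M) B X (f, \<zero>\<^bsub>M\<^esub>) (\<zero>\<^bsub>A\<^esub>, \<xi>)) \<and>
    (\<forall>\<eta>\<in>carrier M. \<forall>\<xi>\<in>carrier M. leibniz_at (semidirect R A M) B X (\<zero>\<^bsub>A\<^esub>, \<eta>) (\<zero>\<^bsub>A\<^esub>, \<xi>))"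
proof -
  interpret A: abelian_group A by fact
  interpret M: abelian_group M by fact
  let ?U = "(\<lambda>f. (f, \<zero>\<^bsub>M\<^esub>)) ` carrier A" and ?V = "Pair \<zero>\<^bsub>A\<^esub> ` carrier M"
  have "\<exists>u\<in>?U. \<exists>v\<in>?V. x = u \<oplus>\<^bsub>semidirect R A M\<^esub> v" if "x \<in> carrier (semidirect R A M)" for x
    using that by (auto simp: semidirect_simps)
  from additive_on_biadditive.leibniz_at_generators[OF add _ _ this]
  show ?thesis by (simp add: semidirect_simps image_subset_iff)
qed

lemma algebra_bilinear_mult:
  assumes "algebra R A" shows "bilinear_map R A A A (mult A)"
proof -
  interpret algebra R A by fact
  have "x \<otimes>\<^bsub>A\<^esub> (r \<odot>\<^bsub>A\<^esub> y) = r \<odot>\<^bsub>A\<^esub> (x \<otimes>\<^bsub>A\<^esub> y)"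
    if "r \<in> carrier R" "x \<in> carrier A" "y \<in> carrier A" for r x y
    using that by (metis m_comm smult_assoc2 smult_closed)
  then show ?thesis
    by (auto simp: bilinear_map_def linear_map_def l_distr r_distr smult_assoc2)
qed

theorem proposition7p7:
  fixes R :: "('r, 'k) ring_scheme"
    and P0 :: "('r, 'a, 'm) module_scheme"
    and P1 :: "('a, 'b, 'n) module_scheme"
    and br0 :: "'a \<Rightarrow> 'a \<Rightarrow> 'a"
    and br :: "'a \<times> 'b \<Rightarrow> 'a \<times> 'b \<Rightarrow> 'a \<times> 'b"
    and br1 :: "'b \<Rightarrow> 'b \<Rightarrow> 'b"
    and D :: "('a \<Rightarrow> 'a) set \<Rightarrow> 'b \<Rightarrow> 'b"
    and K :: "('a \<Rightarrow> 'a) set \<Rightarrow> ('a \<Rightarrow> 'a) set \<Rightarrow> 'b"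
    and X :: "'a \<times> 'b \<Rightarrow> 'a \<times> 'b"
    and X00 :: "'a \<Rightarrow> 'a" and X01 :: "'b \<Rightarrow> 'a" and X10 :: "'a \<Rightarrow> 'b" and X11 :: "'b \<Rightarrow> 'b"
  defines "d \<equiv> kahler_d R P0"
    and "\<T> \<equiv> scrT R P0 P1 D K"
    and "P \<equiv> semidirect R P0 P1"
  assumes adm: "admissible_poisson_algebra R P0 br0 P1 br"
    and triple: "corresponding_triple R P0 br0 P1 br br1 D K"
    and X_linear: "linear_map R P P X"
    and X_maps: "X00 \<in> carrier P0 \<rightarrow> carrier P0" "X01 \<in> carrier P1 \<rightarrow> carrier P0"
      "X10 \<in> carrier P0 \<rightarrow> carrier P1" "X11 \<in> carrier P1 \<rightarrow> carrier P1"
    and X_comps: "\<forall>f\<in>carrier P0. \<forall>\<eta>\<in>carrier P1.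
      X (f, \<eta>) = (X00 f \<oplus>\<^bsub>P0\<^esub> X01 \<eta>, X10 f \<oplus>\<^bsub>P1\<^esub> X11 \<eta>)"
    and X00: "X00 \<in> Der R P0"
    and X01: "X01 \<in> eps P0 P1"
    and X10: "X10 \<in> Der_into R P0 P1"
    and X11: "\<forall>f\<in>carrier P0. \<forall>\<eta>\<in>carrier P1.
      X11 (f \<odot>\<^bsub>P1\<^esub> \<eta>) = (f \<odot>\<^bsub>P1\<^esub> X11 \<eta>) \<oplus>\<^bsub>P1\<^esub> (X00 f \<odot>\<^bsub>P1\<^esub> \<eta>)"
  shows "poisson_derivation R P br X \<longleftrightarrow>
    (\<forall>f\<in>carrier P0. \<forall>\<eta>\<in>carrier P1. \<forall>g\<in>carrier P0. \<forall>\<xi>\<in>carrier P1.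
      X00 (br0 f g) = (br0 (X00 f) g \<oplus>\<^bsub>P0\<^esub> br0 f (X00 g)) \<ominus>\<^bsub>P0\<^esub> X01 (K (d f) (d g)) \<and>
      X11 (br1 \<eta> \<xi>) =
        ((br1 (X11 \<eta>) \<xi> \<oplus>\<^bsub>P1\<^esub> br1 \<eta> (X11 \<xi>)) \<oplus>\<^bsub>P1\<^esub> D (d (X01 \<eta>)) \<xi>) \<ominus>\<^bsub>P1\<^esub> D (d (X01 \<xi>)) \<eta> \<and>
      X10 (br0 f g) =
        (\<T> (X00 f, X10 f) g \<ominus>\<^bsub>P1\<^esub> \<T> (X00 g, X10 g) f) \<ominus>\<^bsub>P1\<^esub> X11 (K (d f) (d g)) \<and>
      X11 (D (d f) \<eta>) =
        (D (d (X00 f)) \<eta> \<oplus>\<^bsub>P1\<^esub> br1 (X10 f) \<eta>) \<ominus>\<^bsub>P1\<^esub> \<T> (X01 \<eta>, X11 \<eta>) f \<and>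
      (\<forall>\<zeta>\<in>carrier P1. X01 (br1 \<eta> \<zeta>) = \<zero>\<^bsub>P0\<^esub>) \<and>
      (\<forall>\<zeta>\<in>carrier P1. X01 (D (d f) \<zeta>) = br0 f (X01 \<zeta>)))"
proof -

  \<comment> \<open>The structure maps: closure and values at zero\<close>
  have pa0: "poisson_algebra R P0 br0" and mod1: "module P0 P1"
    and ps: "poisson_structure R P br"
    using adm by (auto simp: admissible_poisson_algebra_def faithful_module_def P_def)
  have alg0: "algebra R P0" and bil0: "bilinear_map R P0 P0 P0 br0"
    using pa0 by (auto simp: poisson_algebra_def poisson_structure_def lie_bracket_def)
  interpret A: algebra R P0 by (rule alg0)
  interpret M: module P0 P1 by (rule mod1)
  interpret Om: module P0 "kahler R P0" by (rule kahler_module[OF alg0])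
  interpret P: algebra R P unfolding P_def by (rule semidirect_algebra[OF alg0 mod1])
  have A: "abelian_group P0" and M: "abelian_group P1" and Om: "abelian_group (kahler R P0)"
    and AP: "abelian_group P"
    by (rule A.M.abelian_group_axioms M.M.abelian_group_axioms Om.M.abelian_group_axioms
        P.M.abelian_group_axioms)+

  have bil1: "bilinear_map P0 P1 P1 P1 br1"
    and bilD: "bilinear_map R (restrict_scalars R P0 (kahler R P0)) (restrict_scalars R P0 P1)
      (restrict_scalars R P0 P1) D"
    and bilK: "bilinear_map P0 (kahler R P0) (kahler R P0) P1 K"
    and K_skew: "\<And>\<alpha> \<beta>. \<alpha> \<in> carrier (kahler R P0) \<Longrightarrow> \<beta> \<in> carrier (kahler R P0) \<Longrightarrow>
      K \<alpha> \<beta> = \<ominus>\<^bsub>P1\<^esub> K \<beta> \<alpha>"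
    using triple
    unfolding corresponding_triple_def lie_bracket_def contravariant_derivative_def by blast+
  have br: "br (f, \<eta>) (g, \<xi>) =
      (br0 f g, ((D (d f) \<xi> \<ominus>\<^bsub>P1\<^esub> D (d g) \<eta>) \<oplus>\<^bsub>P1\<^esub> br1 \<eta> \<xi>) \<oplus>\<^bsub>P1\<^esub> K (d f) (d g))"
    if "f \<in> carrier P0" "\<eta> \<in> carrier P1" "g \<in> carrier P0" "\<xi> \<in> carrier P1" for f \<eta> g \<xi>
    using triple that by (simp add: corresponding_triple_def d_def)
  note rsM = restrict_scalars_abelian_group[OF M] and rsOm = restrict_scalars_abelian_group[OF Om]
  have d_lin: "linear_map R P0 (restrict_scalars R P0 (kahler R P0)) d"
    using kahler_d_derivation[OF alg0] by (simp add: Der_into_def d_def)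
  have d_closed: "f \<in> carrier P0 \<Longrightarrow> d f \<in> carrier (kahler R P0)" for f
    unfolding d_def by (rule kahler_d_closed[OF alg0])
  have d0: "d \<zero>\<^bsub>P0\<^esub> = \<zero>\<^bsub>kahler R P0\<^esub>"
    using linear_map_zero[OF A rsOm d_lin] by (simp add: restrict_scalars_simps)
  note closed = bilinear_map_closed[OF bil0] bilinear_map_closed[OF bil1]
    bilinear_map_closed[OF bilD, unfolded restrict_scalars_simps] bilinear_map_closed[OF bilK] d_closed
  note zero = bilinear_map_zero[OF A A A bil0] bilinear_map_zero[OF M M M bil1]
    bilinear_map_zero[OF rsOm rsM rsM bilD, unfolded restrict_scalars_simps]
    bilinear_map_zero[OF Om Om M bilK] d0

  \<comment> \<open>The components of \<open>X\<close> at zero, and \<open>X\<close> on homogeneous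
    elements\<close>
  have c00: "\<And>f. f \<in> carrier P0 \<Longrightarrow> X00 f \<in> carrier P0"
    and c01: "\<And>\<eta>. \<eta> \<in> carrier P1 \<Longrightarrow> X01 \<eta> \<in> carrier P0"
    and c10: "\<And>f. f \<in> carrier P0 \<Longrightarrow> X10 f \<in> carrier P1"
    and c11: "\<And>\<eta>. \<eta> \<in> carrier P1 \<Longrightarrow> X11 \<eta> \<in> carrier P1"
    using X_maps by auto
  note X_closed = c00 c01 c10 c11
  have zero00: "X00 \<zero>\<^bsub>P0\<^esub> = \<zero>\<^bsub>P0\<^esub>"
    by (rule linear_map_zero[OF A A, of R]) (use X00 in \<open>simp add: Der_def\<close>)
  have zero01: "X01 \<zero>\<^bsub>P1\<^esub> = \<zero>\<^bsub>P0\<^esub>"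
    using linear_map_zero_minus(1)[OF mod1 regular_module_module[OF alg0]] X01
    by (fastforce simp: eps_def regular_module_def)
  have zero10: "X10 \<zero>\<^bsub>P0\<^esub> = \<zero>\<^bsub>P1\<^esub>"
    using linear_map_zero[OF A rsM, where T = X10] X10
    by (auto simp: Der_into_def restrict_scalars_simps)
  \<comment> \<open>The twisted Leibniz rule for \<open>X11\<close>, taken at zero in both
    arguments, replaces an appeal to additivity.\<close>
  have zero11: "X11 \<zero>\<^bsub>P1\<^esub> = \<zero>\<^bsub>P1\<^esub>"
    using X11[rule_format, of "\<zero>\<^bsub>P0\<^esub>" "\<zero>\<^bsub>P1\<^esub>"] by (simp add: c11 zero00)
  have X0: "X (f, \<zero>\<^bsub>P1\<^esub>) = (X00 f, X10 f)" if "f \<in> carrier P0" for f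
    using X_comps that by (simp add: zero01 zero11 X_closed)
  have X1: "X (\<zero>\<^bsub>P0\<^esub>, \<eta>) = (X01 \<eta>, X11 \<eta>)" if "\<eta> \<in> carrier P1" for \<eta>
    using X_comps that by (simp add: zero00 zero10 X_closed)

  \<comment> \<open>The Leibniz rule for the product\<close>
  have addmult: "additive_on_biadditive P (mult P) X"
    by (rule linear_map_additive_on_biadditive[OF AP X_linear algebra_bilinear_mult[OF P.algebra_axioms]])
      (simp add: P.m_comm)
  have lie: "lie_bracket R P br" using ps by (simp add: poisson_structure_def)
  have addbr: "additive_on_biadditive P br X"
    by (rule linear_map_additive_on_biadditive[OF AP X_linear])
      (use lie lie_bracket_skew[OF AP lie] in \<open>unfold lie_bracket_def, blast+\<close>)

  have "\<forall>x\<in>carrier P. \<forall>y\<in>carrier P. leibniz_at P (mult P) X x y"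
    unfolding P_def semidirect_leibniz_iff[OF A M addmult[unfolded P_def]]
  proof (intro conjI ballI)
    fix f g assume fg: "f \<in> carrier P0" "g \<in> carrier P0"
    have "X00 (f \<otimes>\<^bsub>P0\<^esub> g) = X00 f \<otimes>\<^bsub>P0\<^esub> g \<oplus>\<^bsub>P0\<^esub> f \<otimes>\<^bsub>P0\<^esub> X00 g"
      "X10 (f \<otimes>\<^bsub>P0\<^esub> g) = f \<odot>\<^bsub>P1\<^esub> X10 g \<oplus>\<^bsub>P1\<^esub> g \<odot>\<^bsub>P1\<^esub> X10 f"
      using X00 X10 fg by (simp_all add: Der_def Der_into_def)
    then show "leibniz_at (semidirect R P0 P1) (mult (semidirect R P0 P1)) X (f, \<zero>\<^bsub>P1\<^esub>) (g, \<zero>\<^bsub>P1\<^esub>)"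
      using fg by (simp add: leibniz_at_def semidirect_simps X0 X_closed M.M.a_comm)
  next
    fix f \<xi> assume f\<xi>: "f \<in> carrier P0" "\<xi> \<in> carrier P1"
    \<comment> \<open>This linearity is the \<open>P0\<close>-component of the test; the
      \<open>P1\<close>-component is the twisted rule for \<open>X11\<close>.\<close>
    have "X01 (f \<odot>\<^bsub>P1\<^esub> \<xi>) = f \<otimes>\<^bsub>P0\<^esub> X01 \<xi>"
      using X01 f\<xi> by (simp add: eps_def linear_map_def regular_module_def)
    then show "leibniz_at (semidirect R P0 P1) (mult (semidirect R P0 P1)) X (f, \<zero>\<^bsub>P1\<^esub>) (\<zero>\<^bsub>P0\<^esub>, \<xi>)"
      using f\<xi> X11 by (simp add: leibniz_at_def semidirect_simps X0 X1 X_closed M.M.a_comm)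
  next
    fix \<eta> \<xi> assume \<eta>\<xi>: "\<eta> \<in> carrier P1" "\<xi> \<in> carrier P1"
    \<comment> \<open>Two elements of \<open>P1\<close> have product zero in \<open>P\<close>, so
      the Leibniz rule asks for exactly this sum to vanish.\<close>
    have "X01 \<eta> \<odot>\<^bsub>P1\<^esub> \<xi> \<oplus>\<^bsub>P1\<^esub> X01 \<xi> \<odot>\<^bsub>P1\<^esub> \<eta> = \<zero>\<^bsub>P1\<^esub>"
      using X01 \<eta>\<xi> by (simp add: eps_def)
    then show "leibniz_at (semidirect R P0 P1) (mult (semidirect R P0 P1)) X (\<zero>\<^bsub>P0\<^esub>, \<eta>) (\<zero>\<^bsub>P0\<^esub>, \<xi>)"
      using \<eta>\<xi> by (simp add: leibniz_at_def semidirect_simps X1 X_closed zero01 zero11)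
  qed
  then have "X \<in> Der R P"
    using X_linear by (auto simp: Der_def leibniz_at_def)
  \<comment> \<open>The product half of the definition is settled, so only the bracket half remains
    in the equivalence.\<close>
  then have "poisson_derivation R P br X \<longleftrightarrow> (\<forall>x\<in>carrier P. \<forall>y\<in>carrier P. leibniz_at P br X x y)"
    by (simp add: poisson_derivation_def leibniz_at_def)
  note reduce = this[unfolded P_def semidirect_leibniz_iff[OF A M addbr[unfolded P_def]], folded P_def]

  \<comment> \<open>Brackets with one homogeneous argument\<close>
  have minus_zero1: "\<ominus>\<^bsub>P1\<^esub> \<zero>\<^bsub>P1\<^esub> = \<zero>\<^bsub>P1\<^esub>" by (rule M.M.minus_equality) simp_all
  note alg_simps = closed X_closed zero M.M.minus_eq minus_zero1
  have T_closed: "\<T> (a, \<eta>) g \<in> carrier P1"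
    if "a \<in> carrier P0" "\<eta> \<in> carrier P1" "g \<in> carrier P0" for a \<eta> g
    using that by (simp add: \<T>_def scrT_def closed flip: d_def)
  \<comment> \<open>This is the origin of \<open>\<T>\<close>: against \<open>(g, 0)\<close> the
    terms \<open>D (d a) 0\<close> and \<open>br1 \<eta> 0\<close> drop out, and what is left in
    \<open>P1\<close> is \<open>\<T> (a, \<eta>) g\<close>. The sign in the second equation uses
    \<open>K_skew\<close>.\<close>
  have br_T: "br (a, \<eta>) (g, \<zero>\<^bsub>P1\<^esub>) = (br0 a g, \<T> (a, \<eta>) g)"
    "br (g, \<zero>\<^bsub>P1\<^esub>) (a, \<eta>) = (br0 g a, \<ominus>\<^bsub>P1\<^esub> \<T> (a, \<eta>) g)"
    if "a \<in> carrier P0" "\<eta> \<in> carrier P1" "g \<in> carrier P0" for a \<eta> g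
    using that K_skew[of "d g" "d a"]
    by (simp_all add: br \<T>_def scrT_def alg_simps M.M.minus_add M.M.a_comm flip: d_def)
  \<comment> \<open>Here \<open>d 0 = 0\<close> removes the \<open>K\<close> term and one of the two
    \<open>D\<close> terms.\<close>
  have br_1: "br (a, \<eta>) (\<zero>\<^bsub>P0\<^esub>, \<xi>) = (\<zero>\<^bsub>P0\<^esub>, D (d a) \<xi> \<oplus>\<^bsub>P1\<^esub> br1 \<eta> \<xi>)"
    "br (\<zero>\<^bsub>P0\<^esub>, \<xi>) (a, \<eta>) = (\<zero>\<^bsub>P0\<^esub>, br1 \<xi> \<eta> \<ominus>\<^bsub>P1\<^esub> D (d a) \<xi>)"
    if "a \<in> carrier P0" "\<eta> \<in> carrier P1" "\<xi> \<in> carrier P1" for a \<eta> \<xi>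
    using that by (simp_all add: br alg_simps M.M.a_comm)
  have T_0: "\<T> (f, \<zero>\<^bsub>P1\<^esub>) g = K (d f) (d g)" if "f \<in> carrier P0" "g \<in> carrier P0" for f g
    using that by (simp add: \<T>_def scrT_def alg_simps flip: d_def)
  \<comment> \<open>Both \<open>br_T\<close> and \<open>br_1\<close> match this pair; this is the
    reduced value, without \<open>\<T>\<close> and without a bracket with zero.\<close>
  have br_01: "br (f, \<zero>\<^bsub>P1\<^esub>) (\<zero>\<^bsub>P0\<^esub>, \<xi>) = (\<zero>\<^bsub>P0\<^esub>, D (d f) \<xi>)"
    if "f \<in> carrier P0" "\<xi> \<in> carrier P1" for f \<xi>
    using that by (simp add: br alg_simps)

  \<comment> \<open>These carry the \<open>K\<close> terms, which arise next to
    \<open>X00 (br0 f g)\<close> and \<open>X10 (br0 f g)\<close>, to the other side.\<close>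
  have solve0: "x \<oplus>\<^bsub>P0\<^esub> y = z \<longleftrightarrow> x = z \<ominus>\<^bsub>P0\<^esub> y"
    if "x \<in> carrier P0" "y \<in> carrier P0" "z \<in> carrier P0" for x y z
    using that by (metis A.M.minus_closed A.M.add.inv_solve_right' A.M.minus_eq)
  have solve1: "x \<oplus>\<^bsub>P1\<^esub> y = z \<longleftrightarrow> x = z \<ominus>\<^bsub>P1\<^esub> y"
    if "x \<in> carrier P1" "y \<in> carrier P1" "z \<in> carrier P1" for x y z
    using that by (metis M.M.minus_closed M.M.add.inv_solve_right' M.M.minus_eq)

  \<comment> \<open>The six equations, read off from the three kinds of pairs\<close>
  have L00: "leibniz_at P br X (f, \<zero>\<^bsub>P1\<^esub>) (g, \<zero>\<^bsub>P1\<^esub>) \<longleftrightarrow>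
      X00 (br0 f g) = (br0 (X00 f) g \<oplus>\<^bsub>P0\<^esub> br0 f (X00 g)) \<ominus>\<^bsub>P0\<^esub> X01 (K (d f) (d g)) \<and>
      X10 (br0 f g) =
        (\<T> (X00 f, X10 f) g \<ominus>\<^bsub>P1\<^esub> \<T> (X00 g, X10 g) f) \<ominus>\<^bsub>P1\<^esub> X11 (K (d f) (d g))"
    if fg: "f \<in> carrier P0" "g \<in> carrier P0" for f g
  proof -
    \<comment> \<open>The bracket of two elements of \<open>P0\<close> need not be homogeneous: its
      \<open>P1\<close>-component is \<open>K (d f) (d g)\<close>, so all four components of
      \<open>X\<close> contribute.\<close>
    have "X (br0 f g, K (d f) (d g)) =
        (X00 (br0 f g) \<oplus>\<^bsub>P0\<^esub> X01 (K (d f) (d g)), X10 (br0 f g) \<oplus>\<^bsub>P1\<^esub> X11 (K (d f) (d g)))"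
      using X_comps fg by (simp add: closed)
    then show ?thesis using fg
      by (simp add: leibniz_at_def br_T T_0 X0 X_closed P_def semidirect_simps closed T_closed
          solve0 solve1 flip: M.M.minus_eq)
  qed
  \<comment> \<open>Of the two brackets on the right of the Leibniz rule, \<open>br_1\<close>
    evaluates the one with \<open>X (f, 0)\<close> and \<open>br_T\<close> the one with
    \<open>X (0, \<xi>)\<close>.\<close>
  have L01: "leibniz_at P br X (f, \<zero>\<^bsub>P1\<^esub>) (\<zero>\<^bsub>P0\<^esub>, \<xi>) \<longleftrightarrow>
      X01 (D (d f) \<xi>) = br0 f (X01 \<xi>) \<and>
      X11 (D (d f) \<xi>) =
        (D (d (X00 f)) \<xi> \<oplus>\<^bsub>P1\<^esub> br1 (X10 f) \<xi>) \<ominus>\<^bsub>P1\<^esub> \<T> (X01 \<xi>, X11 \<xi>) f"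
    if "f \<in> carrier P0" "\<xi> \<in> carrier P1" for f \<xi>
    using that
    by (simp add: leibniz_at_def br_01[OF that] br_1 br_T X0 X1 X_closed P_def semidirect_simps closed M.M.minus_eq)
  \<comment> \<open>Both brackets on the right come from \<open>br_1\<close> and lie in
    \<open>P1\<close>; hence \<open>X01\<close> must kill \<open>br1 \<eta> \<xi>\<close>.\<close>
  have L11: "leibniz_at P br X (\<zero>\<^bsub>P0\<^esub>, \<eta>) (\<zero>\<^bsub>P0\<^esub>, \<xi>) \<longleftrightarrow>
      X01 (br1 \<eta> \<xi>) = \<zero>\<^bsub>P0\<^esub> \<and>
      X11 (br1 \<eta> \<xi>) =
        ((br1 (X11 \<eta>) \<xi> \<oplus>\<^bsub>P1\<^esub> br1 \<eta> (X11 \<xi>)) \<oplus>\<^bsub>P1\<^esub> D (d (X01 \<eta>)) \<xi>) \<ominus>\<^bsub>P1\<^esub> D (d (X01 \<xi>)) \<eta>"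
    if "\<eta> \<in> carrier P1" "\<xi> \<in> carrier P1" for \<eta> \<xi>
    using that
    by (simp add: leibniz_at_def br_1 X1 P_def semidirect_simps alg_simps M.M.a_ac)
  \<comment> \<open>The claim quantifies over all four variables at once, while each equation
    involves only some of them. Nonempty carriers let the vacuous quantifiers be dropped.\<close>
  have "carrier P0 \<noteq> {}" "carrier P1 \<noteq> {}" using A.M.zero_closed M.M.zero_closed by blast+
  then show ?thesis
    by (simp add: reduce L00 L01 L11 ball_conj_distrib cong: ball_cong) blast
qed

end
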